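(* There is an absolute constant $C$ such that, for any proper edge-coloring of the complete graph $K_N$, any positive integer $n$ and any real $K>0$, the number of vertex subsets of size $n$ such that at most $Kn$ distinct colors appear on the edges inside the subset is at most $N^{C(K+\ln n)}(CK)^n$.
   Context: A proper edge-coloring is one in which each color class is a matching (maximum degree at most one).
   Formalization: The case n = 1 with K < 1/2 is excluded: for n = 1 all N singletons are counted (no colors appear), while the bound N^{CK}·CK tends to 0 as K → 0, so no absolute C can work there; for n ≥ 2 all K > 0 are covered. *)

theory Defs
  imports Complex_Main "HOL-Library.Ramsey"
begin

text \<open>
  The complete graph \<open>K\<^sub>N\<close> has vertex set \<open>{..<N}\<close>; its edges are the two-element
  subsets, i.e. the elements of \<open>nsets {..<N} 2\<close>. An edge-coloring is a function on edges
  whose values outside the edge set are irrelevant. Vertices and colors are natural numbers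
  rather than type variables, so that a constant quantified in front of the coloring cannot
  depend on a type; as the graph is finite, this is no restriction.
\<close>

abbreviation complete_edges :: "nat \<Rightarrow> nat set set" where
  "complete_edges N \<equiv> nsets {..<N} 2"

definition edge_degree :: "nat set set \<Rightarrow> nat \<Rightarrow> nat" where
  "edge_degree F v = card {e \<in> F. v \<in> e}"

definition is_matching :: "nat \<Rightarrow> nat set set \<Rightarrow> bool" where
  "is_matching N F \<longleftrightarrow> F \<subseteq> complete_edges N \<and> (\<forall>v<N. edge_degree F v \<le> 1)"

definition color_class :: "nat \<Rightarrow> (nat set \<Rightarrow> nat) \<Rightarrow> nat \<Rightarrow> nat set set" where
  "color_class N c a = {e \<in> complete_edges N. c e = a}"

definition proper_edge_coloring :: "nat \<Rightarrow> (nat set \<Rightarrow> nat) \<Rightarrow> bool" where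
  "proper_edge_coloring N c \<longleftrightarrow> (\<forall>a. is_matching N (color_class N c a))"

definition colors_inside :: "(nat set \<Rightarrow> nat) \<Rightarrow> nat set \<Rightarrow> nat set" where
  "colors_inside c S = c ` nsets S 2"

end

theory Submission
  imports Defs "HOL-Library.FuncSet"
begin

text \<open>
  Let \<open>S\<close> be a set of \<open>n\<close> vertices with at most \<open>K n\<close> colours. If \<open>Z \<subseteq> S\<close> is known and every vertex
  of \<open>S - Z\<close> is joined to a positive proportion of \<open>Z\<close> by edges whose colours occur inside \<open>Z\<close>, then
  properness leaves only \<open>O(K n)\<close> candidates for \<open>S - Z\<close>, hence \<open>(C K)^n\<close> choices. A vertex
  violating this condition brings many new colours, so few vertices have to be added to \<open>Z\<close> to
  enforce it. It remains to describe a suitable \<open>Z\<close> cheaply.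

  For \<open>K \<le> sqrt n\<close>: \<open>O(K + ln n)\<close> vertices generate all of \<open>S\<close> under the operation ``follow an edge
  whose colour has already been seen''. Call vertices equivalent over \<open>X\<close> if, added to \<open>X\<close>, they
  generate the same set. A new vertex either sees \<open>n/4\<close> colours not yet incident to the generated
  set, or else some new vertex merges a constant fraction of the classes. Each generation step costs
  a factor polynomial in \<open>n\<close>, and only \<open>O(sqrt (K n))\<close> of them are needed.

  For \<open>K \<ge> sqrt n\<close>: given \<open>Z\<close> with \<open>i\<close> elements, the colours spanned by about \<open>sqrt (n/i)\<close> random
  vertices of \<open>S\<close> lead from \<open>Z\<close> to \<open>O(n)\<close> vertices, of which at least a constant times \<open>n/K\<close> are
  new elements of \<open>S\<close>. After \<open>O(K)\<close> rounds, which use \<open>O(K)\<close> random vertices altogether,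
  \<open>Z\<close> contains \<open>n/4\<close> elements.
\<close>

section \<open>Generating a vertex set by few vertices\<close>

text \<open>Edges are ordered pairs under a symmetric colour function. The values
  \<open>d v v\<close> carry no meaning, so \<open>cols\<close> and all later notions demand
  distinct endpoints. \<open>d_inj\<close> is properness read off at one vertex.\<close>

locale proper_coloring =
  fixes V :: "'a set" and d :: "'a \<Rightarrow> 'a \<Rightarrow> 'b"
  assumes finite_V: "finite V"
    and d_commute: "d u v = d v u"
    and d_inj: "\<lbrakk>v \<in> V; u \<in> V; w \<in> V; u \<noteq> v; w \<noteq> v; d v u = d v w\<rbrakk> \<Longrightarrow> u = w"
begin

definition cols :: "'a set \<Rightarrow> 'a set \<Rightarrow> 'b set" where
  "cols A B = {d u v |u v. u \<in> A \<and> v \<in> B \<and> u \<noteq> v}"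

lemma colsI: "\<lbrakk>u \<in> A; v \<in> B; u \<noteq> v\<rbrakk> \<Longrightarrow> d u v \<in> cols A B"
  unfolding cols_def by blast

lemma colsE:
  assumes "a \<in> cols A B"
  obtains u v where "u \<in> A" "v \<in> B" "u \<noteq> v" "a = d u v"
  using assms unfolding cols_def by blast

lemma cols_mono: "\<lbrakk>A \<subseteq> A'; B \<subseteq> B'\<rbrakk> \<Longrightarrow> cols A B \<subseteq> cols A' B'"
  unfolding cols_def by blast

lemma finite_cols: "\<lbrakk>finite A; finite B\<rbrakk> \<Longrightarrow> finite (cols A B)"
  by (rule finite_subset[of _ "(\<lambda>(u, v). d u v) ` (A \<times> B)"]) (auto simp: cols_def)

lemma inj_on_star: "\<lbrakk>v \<in> V; A \<subseteq> V - {v}\<rbrakk> \<Longrightarrow> inj_on (d v) A"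
  by (rule inj_onI) (metis DiffE d_inj insertCI subsetD)

text \<open>Only vertices of \<open>S\<close> are adjoined, although the same colours may also lead
  to vertices of \<open>V\<close> outside \<open>S\<close>. The latter matter only when the choices
  are counted, in \<open>card_extends_le\<close>.\<close>

inductive_set gen :: "'a set \<Rightarrow> 'a set \<Rightarrow> 'a set" for S X where
  gen_base: "x \<in> X \<Longrightarrow> x \<in> gen S X"
| gen_step: "\<lbrakk>v \<in> S; z \<in> gen S X; a \<in> gen S X; b \<in> gen S X; v \<noteq> z; a \<noteq> b; d v z = d a b\<rbrakk>
    \<Longrightarrow> v \<in> gen S X"

lemma gen_subset: "X \<subseteq> S \<Longrightarrow> gen S X \<subseteq> S"
proof
  fix x assume "x \<in> gen S X" "X \<subseteq> S"
  then show "x \<in> S" by (induction rule: gen.induct) auto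
qed

lemma gen_minimal:
  assumes "X \<subseteq> gen S Y" shows "gen S X \<subseteq> gen S Y"
proof
  fix x assume "x \<in> gen S X"
  then show "x \<in> gen S Y"
    by (induction rule: gen.induct) (use assms in \<open>auto intro: gen_step\<close>)
qed

lemma gen_mono: "X \<subseteq> Y \<Longrightarrow> gen S X \<subseteq> gen S Y"
  by (rule gen_minimal) (auto intro: gen_base)

text \<open>Adjoining \<open>x\<close> thus acts on closures: the map
  \<open>E \<mapsto> gen S (insert x E)\<close> takes the classes over \<open>X\<close> onto the
  classes over \<open>insert x X\<close>, and this is the map that merges them.\<close>

lemma gen_insert_gen: "gen S (insert x (gen S Y)) = gen S (insert x Y)"
proof (rule antisym)
  have "gen S Y \<subseteq> gen S (insert x Y)" by (rule gen_mono) auto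
  then show "gen S (insert x (gen S Y)) \<subseteq> gen S (insert x Y)"
    by (intro gen_minimal) (auto intro: gen_base)
  show "gen S (insert x Y) \<subseteq> gen S (insert x (gen S Y))"
    by (rule gen_mono) (auto intro: gen_base)
qed

text \<open>Once \<open>v\<close> is adjoined, the colour of the edge from \<open>v\<close> to
  \<open>z\<close> occurs inside the closure. The edge from \<open>z'\<close> to \<open>w\<close>
  has the same colour, so \<open>w\<close> is generated.\<close>

lemma gen_insert_subset_of_color:
  assumes "w \<in> S" "z \<in> gen S X" "z' \<in> gen S (insert v X)" "v \<noteq> z" "w \<noteq> z'" "d v z = d w z'"
  shows "gen S (insert w X) \<subseteq> gen S (insert v X)"
proof (rule gen_minimal)
  have 1: "z \<in> gen S (insert v X)" using assms(2) gen_mono[of X "insert v X" S] by auto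
  have "w \<in> gen S (insert v X)"
    using assms(1,3-6) 1 gen_base[of v "insert v X" S] by (auto intro: gen_step[of w S z' _ v z])
  then show "insert w X \<subseteq> gen S (insert v X)" by (auto intro: gen_base)
qed

text \<open>The previous lemma in both directions. Consequently, different classes are joined to the
  closure by disjoint sets of colours.\<close>

lemma gen_insert_eq_of_color:
  assumes "v \<in> S" "w \<in> S" "z \<in> gen S X" "z' \<in> gen S X" "v \<noteq> z" "w \<noteq> z'" "d v z = d w z'"
  shows "gen S (insert v X) = gen S (insert w X)"
proof -
  have m: "gen S X \<subseteq> gen S (insert y X)" for y by (rule gen_mono) auto
  show ?thesis
    using assms m gen_insert_subset_of_color[of w S z X z' v] gen_insert_subset_of_color[of v S z' X z w]
    by auto
qed

text \<open>If no such \<open>u\<close> existed, \<open>Z\<close> would be closed under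
  \<open>gen_step\<close> and would contain \<open>gen S X = S\<close>.\<close>

lemma ex_not_closed:
  assumes "gen S X = S" "X \<subseteq> Z" "Z \<subset> S"
  obtains u z a b where "u \<in> S - Z" "z \<in> Z" "a \<in> Z" "b \<in> Z" "a \<noteq> b" "d u z = d a b"
proof (rule ccontr)
  assume no: "\<not> thesis"
  have "x \<in> gen S X \<Longrightarrow> x \<in> Z" for x
  proof (induction rule: gen.induct)
    case (gen_base x) then show ?case using assms by auto
  next
    case (gen_step v z a b)
    show ?case
    proof (rule ccontr)
      assume "v \<notin> Z"
      then have thesis using gen_step by (intro that[of v z a b]) auto
      then show False using no by contradiction
    qed
  qed
  then show False using assms by auto
qed

text \<open>An equivalence class over \<open>X\<close> is represented by the common closure of its
  members instead of its block of vertices; the number of classes is the same.\<close>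

abbreviation classes :: "'a set \<Rightarrow> 'a set \<Rightarrow> 'a set set" where
  "classes S X \<equiv> (\<lambda>v. gen S (insert v X)) ` S"

end

section \<open>Merging equivalence classes\<close>

text \<open>A fibre of \<open>f\<close> that meets \<open>H\<close> has at least two elements, so
  collapsing it to one value loses at least half of it. Summed over the fibres, the loss is at least
  half of \<open>card H\<close>.\<close>

lemma card_image_le_of_partners:
  assumes "finite Q" "H \<subseteq> Q"
    and "\<And>E. E \<in> H \<Longrightarrow> \<exists>E'\<in>Q. E' \<noteq> E \<and> f E' = f E"
  shows "card H + 2 * card (f ` Q) \<le> 2 * card Q"
proof -
  let ?F = "\<lambda>y. {E\<in>Q. f E = y}"
  have fib: "card (H \<inter> ?F y) + 2 \<le> 2 * card (?F y)" if "y \<in> f ` Q" for y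
  proof (cases "H \<inter> ?F y = {}")
    case True
    have "?F y \<noteq> {}" using that by auto
    then have "card (?F y) \<ge> 1" using assms(1) by (simp add: Suc_le_eq card_gt_0_iff)
    then show ?thesis using True by simp
  next
    case False
    then obtain E where E: "E \<in> H" "f E = y" by auto
    then obtain E' where "E' \<in> Q" "E' \<noteq> E" "f E' = y" using assms(3) by metis
    then have "{E, E'} \<subseteq> ?F y" using E assms(2) by auto
    then have "card {E, E'} \<le> card (?F y)" using assms(1) by (intro card_mono) auto
    moreover have "card (H \<inter> ?F y) \<le> card (?F y)" using assms(1) by (intro card_mono) auto
    ultimately show ?thesis using \<open>E' \<noteq> E\<close> by simp
  qed
  have Q: "card Q = (\<Sum>y\<in>f ` Q. card (?F y))"
    using assms(1) by (subst card_UN_disjoint[symmetric]) (auto intro!: arg_cong[where f=card])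
  have H: "card H = (\<Sum>y\<in>f ` Q. card (H \<inter> ?F y))"
    using assms(1,2) by (subst card_UN_disjoint[symmetric]) (auto intro!: arg_cong[where f=card])
  have "card H + 2 * card (f ` Q) = (\<Sum>y\<in>f ` Q. card (H \<inter> ?F y) + 2)"
    unfolding H sum.distrib by simp
  also have "\<dots> \<le> (\<Sum>y\<in>f ` Q. 2 * card (?F y))" by (rule sum_mono) (rule fib)
  also have "\<dots> = 2 * card Q" unfolding Q sum_distrib_left ..
  finally show ?thesis .
qed

text \<open>Double counting of the incidences \<open>x \<in> B E\<close>, followed by averaging over
  \<open>S\<close>.\<close>

lemma ex_popular:
  fixes B :: "'e \<Rightarrow> 'x set" and m :: real
  assumes "finite S" "finite G" "S \<noteq> {}"
    and "\<And>E. E \<in> G \<Longrightarrow> B E \<subseteq> S" and "\<And>E. E \<in> G \<Longrightarrow> real (card (B E)) \<ge> m * real (card S)"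
  shows "\<exists>x\<in>S. real (card {E\<in>G. x \<in> B E}) \<ge> m * real (card G)"
proof (rule ccontr)
  assume "\<not> ?thesis"
  then have less: "real (card {E\<in>G. x \<in> B E}) < m * real (card G)" if "x \<in> S" for x
    using that by force
  have "(\<Sum>x\<in>S. card {E\<in>G. x \<in> B E}) = (\<Sum>E\<in>G. card {x\<in>S. x \<in> B E})"
    by (rule sum_multicount_gen) (use assms in auto)
  also have "\<dots> = (\<Sum>E\<in>G. card (B E))"
    by (rule sum.cong) (use assms(4) in \<open>auto intro!: arg_cong[where f=card]\<close>)
  finally have eq: "(\<Sum>x\<in>S. real (card {E\<in>G. x \<in> B E})) = (\<Sum>E\<in>G. real (card (B E)))"
    by (simp flip: of_nat_sum)
  have "(\<Sum>x\<in>S. real (card {E\<in>G. x \<in> B E})) < (\<Sum>x\<in>S. m * real (card G))"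
    by (rule sum_strict_mono) (use assms less in auto)
  also have "\<dots> = (\<Sum>E\<in>G. m * real (card S))" by simp
  also have "\<dots> \<le> (\<Sum>E\<in>G. real (card (B E)))" by (rule sum_mono) (use assms in auto)
  finally show False using eq by simp
qed

context proper_coloring
begin

text \<open>Classes have disjoint sets of colours towards the closure, so fewer than half of them
  use more than \<open>n/5\<close> colours there. A representative of any other class sends, to at
  least \<open>n/4\<close> vertices, edges whose colours attach different classes to the closure. A
  vertex \<open>x\<close> that is popular in this respect merges at least an eighth of all classes
  with others, which removes a sixteenth of them.\<close>

lemma merge_classes:
  assumes S: "S \<subseteq> V" and X: "X \<subseteq> S" "X \<noteq> {}"
    and K: "real (card (cols S S)) \<le> K * real (card S)" "K \<ge> 1/2"
    and q: "real (card (classes S X)) > 10 * K"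
    and few: "\<And>x. x \<in> S \<Longrightarrow>
      real (card {u\<in>S - {x}. d x u \<notin> cols (gen S X) S}) < real (card S) / 4"
  shows "\<exists>x\<in>S. real (card (classes S (insert x X))) \<le> 15/16 * real (card (classes S X))"
proof -
  let ?n = "real (card S)" and ?Q = "classes S X"
  have fS: "finite S" using S finite_V finite_subset by blast
  have fQ: "finite ?Q" using fS by simp
  have Sne: "S \<noteq> {}" using X by auto
  have gS: "gen S X \<subseteq> S" using X(1) by (rule gen_subset)
  have "card ?Q \<le> card S" using fS by (rule card_image_le)
  then have "?n > 5" using q K(2) by linarith
  then have n6: "?n \<ge> 6" by simp
  \<comment> \<open>The colours by which the class \<open>E\<close> is attached to the
    closure.\<close>
  define A where "A E = {d w z |w z. w \<in> S \<and> gen S (insert w X) = E \<and> z \<in> gen S X \<and> w \<noteq> z}" for E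
  have A_sub: "A E \<subseteq> cols S S" for E unfolding A_def cols_def using gS by blast
  have fC: "finite (cols S S)" using fS by (rule finite_cols[OF _ fS])
  have A_disj: "A E \<inter> A E' = {}" if "E \<noteq> E'" for E E'
    using that gen_insert_eq_of_color unfolding A_def by blast
  have sumA: "(\<Sum>E\<in>?Q. real (card (A E))) \<le> K * ?n"
  proof -
    have "(\<Sum>E\<in>?Q. card (A E)) = card (\<Union>E\<in>?Q. A E)"
      by (rule card_UN_disjoint[symmetric]) (use fQ A_disj finite_subset[OF A_sub fC] in auto)
    also have "\<dots> \<le> card (cols S S)" by (rule card_mono) (use fC A_sub in auto)
    finally have "real (\<Sum>E\<in>?Q. card (A E)) \<le> real (card (cols S S))" by (rule of_nat_mono)
    then show ?thesis using K(1) unfolding of_nat_sum by linarith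
  qed
  define G where "G = {E\<in>?Q. real (card (A E)) \<le> ?n / 5}"
  have fG: "finite G" unfolding G_def using fQ by simp
  have bad: "real (card (?Q - G)) \<le> 5 * K"
  proof -
    have "real (card (?Q - G)) * (?n / 5) = (\<Sum>E\<in>?Q - G. ?n / 5)" by simp
    also have "\<dots> \<le> (\<Sum>E\<in>?Q - G. real (card (A E)))" by (rule sum_mono) (auto simp: G_def)
    also have "\<dots> \<le> (\<Sum>E\<in>?Q. real (card (A E)))" by (rule sum_mono2) (use fQ in auto)
    finally have "real (card (?Q - G)) * ?n \<le> (5 * K) * ?n" using sumA by linarith
    then show ?thesis using n6 by (simp add: mult_le_cancel_right)
  qed
  have "card ?Q = card (?Q - G) + card G"
    by (metis (no_types, lifting) G_def card_Diff_subset card_mono fG fQ le_add_diff_inverse2 mem_Collect_eq subsetI)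
  then have G_large: "real (card G) \<ge> real (card ?Q) / 2" using bad q by simp
  define rep where "rep E = (SOME v. v \<in> S \<and> gen S (insert v X) = E)" for E
  have rep: "rep E \<in> S \<and> gen S (insert (rep E) X) = E" if "E \<in> ?Q" for E
    unfolding rep_def by (rule someI_ex) (use that in auto)
  \<comment> \<open>For these \<open>x\<close>, the colour of the edge from \<open>rep E\<close> to
    \<open>x\<close> also attaches some other class to the closure, and adjoining \<open>x\<close>
    identifies the two classes.\<close>
  define B where "B E = {x\<in>S - {rep E}. d (rep E) x \<in> cols (gen S X) S - A E}" for E
  have B_large: "real (card (B E)) \<ge> 1/4 * ?n" if "E \<in> G" for E
  proof -
    let ?v = "rep E"
    have v: "?v \<in> S" "gen S (insert ?v X) = E" using that rep G_def by auto
    let ?N = "{u\<in>S - {?v}. d ?v u \<notin> cols (gen S X) S}"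
    let ?I = "{u\<in>S - {?v}. d ?v u \<in> A E}"
    have "inj_on (d ?v) ?I" by (rule inj_on_star) (use v S in auto)
    then have "card ?I = card (d ?v ` ?I)" by (simp add: card_image)
    also have "\<dots> \<le> card (A E)" by (rule card_mono) (use finite_subset[OF A_sub fC] in auto)
    finally have I: "real (card ?I) \<le> ?n / 5" using that unfolding G_def by simp
    have "card S - 1 = card (S - {?v})" using v fS by simp
    also have "\<dots> \<le> card (B E \<union> ?N \<union> ?I)" by (rule card_mono) (use fS in \<open>auto simp: B_def\<close>)
    also have "\<dots> \<le> card (B E) + card ?N + card ?I"
      by (meson add_mono card_Un_le le_refl le_trans)
    finally have "?n - 1 \<le> real (card (B E)) + real (card ?N) + real (card ?I)" by linarith
    \<comment> \<open>What remains is \<open>?n - 1 - ?n/4 - ?n/5\<close>, which exceeds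
      \<open>?n/4\<close> by \<open>3/10 * ?n - 1\<close>; this is positive as
      \<open>?n \<ge> 6\<close>.\<close>
    then show ?thesis using I few[OF v(1)] n6 by linarith
  qed
  obtain x where x: "x \<in> S" "real (card {E\<in>G. x \<in> B E}) \<ge> 1/4 * real (card G)"
    using ex_popular[of S G B "1/4"] fS fG Sne B_large by (auto simp: B_def)
  define H where "H = {E\<in>G. x \<in> B E}"
  define f where "f E = gen S (insert x E)" for E
  have fimg: "f ` ?Q = classes S (insert x X)"
    unfolding f_def image_image gen_insert_gen by (simp add: insert_commute)
  have partner: "\<exists>E'\<in>?Q. E' \<noteq> E \<and> f E' = f E" if "E \<in> H" for E
  proof -
    let ?v = "rep E"
    have v: "?v \<in> S" "gen S (insert ?v X) = E" using that rep G_def H_def by auto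
    have xv: "x \<noteq> ?v" "d ?v x \<in> cols (gen S X) S" "d ?v x \<notin> A E"
      using that unfolding H_def B_def by auto
    from xv(2) obtain z w where zw: "z \<in> gen S X" "w \<in> S" "z \<noteq> w" "d ?v x = d z w" by (rule colsE)
    have "gen S (insert w X) \<noteq> E" using xv(3) zw unfolding A_def by (auto simp: d_commute)
    moreover have "f (gen S (insert w X)) = f E"
    proof -
      have zx: "z \<in> gen S (insert x X)" using zw(1) gen_mono[of X "insert x X" S] by auto
      \<comment> \<open>Over \<open>insert x X\<close> both \<open>x\<close> and \<open>z\<close>
        lie in the closure, and the edges from \<open>?v\<close> to \<open>x\<close> and from
        \<open>w\<close> to \<open>z\<close> have the same colour.\<close>
      have "gen S (insert ?v (insert x X)) = gen S (insert w (insert x X))"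
        by (rule gen_insert_eq_of_color[of _ _ _ x _ z])
          (use v(1) zw zx x(1) xv(1) d_commute[of z w] in \<open>auto intro: gen_base\<close>)
      then have "gen S (insert x (gen S (insert ?v X))) = gen S (insert x (gen S (insert w X)))"
        unfolding gen_insert_gen by (simp add: insert_commute)
      then show ?thesis unfolding f_def v(2) ..
    qed
    ultimately show ?thesis using zw(2) by blast
  qed
  have "card H + 2 * card (f ` ?Q) \<le> 2 * card ?Q"
    by (rule card_image_le_of_partners) (use fQ partner in \<open>auto simp: H_def G_def\<close>)
  then have "real (card H) + 2 * real (card (f ` ?Q)) \<le> 2 * real (card ?Q)" by linarith
  moreover have "real (card H) \<ge> real (card ?Q) / 8" using x(2) G_large unfolding H_def by linarith
  ultimately show ?thesis using x(1) fimg by (intro bexI[of _ x]) auto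
qed

text \<open>A maximal \<open>X\<close> is taken in which each vertex after the first has paid for
  itself, either with \<open>n/4\<close> new colours at the closure or by cutting the number of
  classes to \<open>15/16\<close>. While more than \<open>10 * K\<close> classes remain,
  \<open>merge_classes\<close> shows that another vertex can pay.\<close>

lemma ex_few_classes:
  assumes S: "S \<subseteq> V" "S \<noteq> {}"
    and K: "real (card (cols S S)) \<le> K * real (card S)" "K \<ge> 1/2"
  shows "\<exists>X\<subseteq>S. real (card X) \<le> 1 + 4 * K + log (16/15) (real (card S))
    \<and> real (card (classes S X)) \<le> 10 * K"
proof -
  let ?n = "real (card S)" and ?q = "\<lambda>X. real (card (classes S X))"
  let ?T = "\<lambda>X. real (card (cols (gen S X) S))"
  have fS: "finite S" using S finite_V finite_subset by blast
  have n: "?n \<ge> 1" using S fS by (simp add: Suc_le_eq card_gt_0_iff)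
  have q1: "?q X \<ge> 1" for X using S(2) fS by (simp add: Suc_le_eq card_gt_0_iff)
  have qn: "?q X \<le> ?n" for X using fS by (simp add: card_image_le)
  have fC: "finite (cols S S)" using fS by (rule finite_cols[OF _ fS])
  have T_sub: "cols (gen S X) S \<subseteq> cols S S" if "X \<subseteq> S" for X
    using gen_subset[OF that] by (intro cols_mono) auto
  have TK: "?T X \<le> K * ?n" if "X \<subseteq> S" for X
    using K(1) card_mono[OF fC T_sub[OF that]] by linarith
  \<comment> \<open>Each payment raises the potential
    \<open>4 * ?T X / ?n - log (16/15) (?q X)\<close> by at least 1. The term
    \<open>log (16/15) ?n\<close> lets a singleton satisfy \<open>P\<close>, because
    \<open>?q \<le> ?n\<close>.\<close>
  define P where "P X \<longleftrightarrow> X \<subseteq> S \<and> X \<noteq> {} \<and>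
    real (card X) \<le> 1 + 4 * ?T X / ?n - log (16/15) (?q X) + log (16/15) ?n" for X
  obtain x0 where x0: "x0 \<in> S" using S by auto
  have "P {x0}" unfolding P_def using x0 qn[of "{x0}"] q1[of "{x0}"] n by simp
  moreover have "\<forall>X. P X \<longrightarrow> card X < Suc (card S)"
    unfolding P_def by (auto simp: less_Suc_eq_le intro: card_mono[OF fS])
  ultimately obtain X where X: "P X" and Xmax: "\<And>Y. P Y \<Longrightarrow> card Y \<le> card X"
    using ex_has_greatest_nat[of P "{x0}" card "Suc (card S)"] by auto
  have XS: "X \<subseteq> S" "X \<noteq> {}" using X unfolding P_def by auto
  have fX: "finite X" using XS fS finite_subset by blast
  have le: "?q (insert x X) \<le> ?q X" for x
  proof -
    have "classes S (insert x X) = (\<lambda>E. gen S (insert x E)) ` classes S X"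
      unfolding image_image gen_insert_gen by (simp add: insert_commute)
    then show ?thesis using fS by (simp add: card_image_le)
  qed
  have Tmono: "cols (gen S X) S \<subseteq> cols (gen S (insert x X)) S" for x
    by (intro cols_mono gen_mono) auto
  have noext: "x \<in> X \<or>
      4 * ?T (insert x X) / ?n - log (16/15) (?q (insert x X)) < 4 * ?T X / ?n - log (16/15) (?q X) + 1"
    if x: "x \<in> S" for x
  proof (rule ccontr)
    assume a: "\<not> ?thesis"
    then have xX: "x \<notin> X" by blast
    then have c: "card (insert x X) = Suc (card X)" using fX by simp
    have "real (card X) \<le> 1 + 4 * ?T X / ?n - log (16/15) (?q X) + log (16/15) ?n"
      using X unfolding P_def by blast
    then have "real (card (insert x X))
        \<le> 1 + 4 * ?T (insert x X) / ?n - log (16/15) (?q (insert x X)) + log (16/15) ?n"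
      using a c by linarith
    then have "P (insert x X)" using XS x unfolding P_def by blast
    then show False using Xmax c by fastforce
  qed
  have "?q X \<le> 10 * K"
  proof (rule ccontr)
    assume q: "\<not> ?thesis"
    have few: "real (card {u\<in>S - {x}. d x u \<notin> cols (gen S X) S}) < ?n / 4" if x: "x \<in> S" for x
    proof (rule ccontr)
      let ?U = "{u\<in>S - {x}. d x u \<notin> cols (gen S X) S}"
      assume a: "\<not> ?thesis"
      have fT: "finite (cols (gen S (insert x X)) S)"
        by (rule finite_subset[OF T_sub fC]) (use XS x in auto)
      have xg: "x \<in> gen S (insert x X)" by (auto intro: gen_base)
      have "card (cols (gen S X) S) + card ?U = card (cols (gen S X) S) + card (d x ` ?U)"
        using inj_on_star[of x ?U] x S by (subst card_image) auto
      also have "\<dots> = card (cols (gen S X) S \<union> d x ` ?U)"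
        using fT Tmono[of x] fS by (subst card_Un_disjoint) (auto intro: finite_subset)
      also have "\<dots> \<le> card (cols (gen S (insert x X)) S)"
        using xg Tmono[of x] fT by (intro card_mono) (auto intro: colsI)
      finally have "?T X + real (card ?U) \<le> ?T (insert x X)" by linarith
      then have "4 * ?T (insert x X) \<ge> 4 * ?T X + ?n" using a by linarith
      then have "(4 * ?T X + ?n) / ?n \<le> 4 * ?T (insert x X) / ?n"
        by (rule divide_right_mono) simp
      then have "4 * ?T (insert x X) / ?n \<ge> 4 * ?T X / ?n + 1"
        using n by (simp add: add_divide_distrib)
      moreover have "log (16/15) (?q (insert x X)) \<le> log (16/15) (?q X)"
        using le[of x] q1[of "insert x X"] q1[of X] by (subst log_le_cancel_iff) auto
      moreover have "x \<notin> X"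
      proof
        assume "x \<in> X"
        then have "insert x X = X" by auto
        then show False using \<open>?T X + real (card ?U) \<le> ?T (insert x X)\<close> a n by auto
      qed
      ultimately show False using noext[OF x] by auto
    qed
    obtain x where x: "x \<in> S" "?q (insert x X) \<le> 15/16 * ?q X"
      using merge_classes[OF S(1) XS K _ few] q by auto
    have "log (16/15) (?q (insert x X)) \<le> log (16/15) (15/16 * ?q X)"
      using x q1[of "insert x X"] q1[of X] by (subst log_le_cancel_iff) auto
    also have "\<dots> = log (16/15) (?q X / (16/15))" by (simp add: field_simps)
    also have "\<dots> = log (16/15) (?q X) - 1"
      using q1[of X] by (subst log_divide) auto
    finally have 1: "log (16/15) (?q (insert x X)) \<le> log (16/15) (?q X) - 1" .
    have "?T X \<le> ?T (insert x X)"
      using card_mono[OF finite_subset[OF T_sub fC] Tmono[of x]] XS x(1) by auto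
    then have "4 * ?T X / ?n \<le> 4 * ?T (insert x X) / ?n" using n by (simp add: divide_right_mono)
    moreover have "x \<notin> X"
    proof
      assume "x \<in> X"
      then have "insert x X = X" by auto
      then show False using 1 by simp
    qed
    ultimately show False using noext[OF x(1)] 1 by auto
  qed
  moreover have "4 * ?T X / ?n \<le> 4 * K" using TK[OF XS(1)] n by (simp add: field_simps)
  moreover have "log (16/15) (?q X) \<ge> 0" using q1[of X] by simp
  ultimately show ?thesis using X unfolding P_def by (intro exI[of _ X]) auto
qed

text \<open>One representative of each of the at most \<open>10 * K\<close> remaining classes is
  adjoined; every vertex lies in the closure generated by its own representative.\<close>

lemma ex_generators:
  assumes S: "S \<subseteq> V" "S \<noteq> {}"
    and K: "real (card (cols S S)) \<le> K * real (card S)" "K \<ge> 1/2"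
  shows "\<exists>X\<subseteq>S. real (card X) \<le> 1 + 14 * K + log (16/15) (real (card S)) \<and> gen S X = S"
proof -
  obtain X where X: "X \<subseteq> S" "real (card X) \<le> 1 + 4 * K + log (16/15) (real (card S))"
    "real (card (classes S X)) \<le> 10 * K"
    using ex_few_classes[OF assms] by auto
  have fS: "finite S" using S finite_V finite_subset by blast
  define rep where "rep E = (SOME v. v \<in> S \<and> gen S (insert v X) = E)" for E
  have rep: "rep E \<in> S \<and> gen S (insert (rep E) X) = E" if "E \<in> classes S X" for E
    unfolding rep_def by (rule someI_ex) (use that in auto)
  let ?Y = "X \<union> rep ` classes S X"
  have Y: "?Y \<subseteq> S" using X rep by auto
  have "v \<in> gen S ?Y" if "v \<in> S" for v
  proof -
    let ?E = "gen S (insert v X)"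
    have E: "?E \<in> classes S X" using that by auto
    have "v \<in> ?E" by (auto intro: gen_base)
    also have "?E = gen S (insert (rep ?E) X)" using rep[OF E] by simp
    also have "\<dots> \<subseteq> gen S ?Y" using E by (intro gen_mono) auto
    finally show ?thesis .
  qed
  then have "gen S ?Y = S" using gen_subset[OF Y] by auto
  moreover have "card ?Y \<le> card X + card (classes S X)"
    by (meson add_left_mono card_Un_le card_image_le finite_imageI fS order_trans)
  then have "real (card ?Y) \<le> 1 + 14 * K + log (16/15) (real (card S))" using X by linarith
  ultimately show ?thesis using Y by blast
qed

end

section \<open>Candidates determined by known colours\<close>

context proper_coloring
begin

definition nbrs :: "'a set \<Rightarrow> 'b set \<Rightarrow> 'a set" where
  "nbrs Z D = {v\<in>V. \<exists>z\<in>Z. v \<noteq> z \<and> d v z \<in> D}"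

lemma finite_nbrs: "finite (nbrs Z D)"
  unfolding nbrs_def using finite_V by simp

lemma nbrs_mono: "\<lbrakk>Z \<subseteq> Z'; D \<subseteq> D'\<rbrakk> \<Longrightarrow> nbrs Z D \<subseteq> nbrs Z' D'"
  unfolding nbrs_def by blast

text \<open>By properness, \<open>z\<close> has at most one neighbour in each colour. All bounds on
  the number of candidates rest on this.\<close>

lemma card_color_star_le:
  assumes "z \<in> V" "finite D"
  shows "card {v\<in>V. v \<noteq> z \<and> d v z \<in> D} \<le> card D"
proof -
  have "inj_on (d z) {v\<in>V. v \<noteq> z \<and> d v z \<in> D}" by (rule inj_on_star) (use assms in auto)
  then show ?thesis
    by (rule card_inj_on_le) (use assms d_commute in auto)
qed

lemma card_nbrs_le:
  assumes "Z \<subseteq> V" "finite D"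
  shows "card (nbrs Z D) \<le> card Z * card D"
proof -
  have fZ: "finite Z" using assms(1) finite_V by (rule finite_subset)
  have "nbrs Z D = (\<Union>z\<in>Z. {v\<in>V. v \<noteq> z \<and> d v z \<in> D})" unfolding nbrs_def by blast
  then have "card (nbrs Z D) \<le> (\<Sum>z\<in>Z. card {v\<in>V. v \<noteq> z \<and> d v z \<in> D})"
    by (simp add: card_UN_le[OF fZ])
  also have "\<dots> \<le> (\<Sum>z\<in>Z. card D)"
    by (rule sum_mono, rule card_color_star_le) (use assms in auto)
  finally show ?thesis by simp
qed

lemma card_cols_le: "finite Z \<Longrightarrow> card (cols Z Z) \<le> card Z * card Z"
proof -
  assume f: "finite Z"
  have "cols Z Z \<subseteq> (\<lambda>(u, v). d u v) ` (Z \<times> Z)" unfolding cols_def by auto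
  then have "card (cols Z Z) \<le> card ((\<lambda>(u, v). d u v) ` (Z \<times> Z))" using f by (intro card_mono) auto
  also have "\<dots> \<le> card (Z \<times> Z)" using f by (intro card_image_le) auto
  finally show ?thesis by (simp add: card_cartesian_product)
qed

section \<open>Vertices well linked to a set\<close>

definition links :: "'a set \<Rightarrow> 'a \<Rightarrow> 'a set" where
  "links Z v = {z\<in>Z. v \<noteq> z \<and> d v z \<in> cols Z Z}"

text \<open>The threshold is \<open>t/2\<close> links, doubled to stay within the naturals. The set
  depends on \<open>Z\<close> but not on \<open>S\<close>, so it can serve as the set of candidates
  for the rest of \<open>S\<close>.\<close>

definition rich :: "nat \<Rightarrow> 'a set \<Rightarrow> 'a set" where
  "rich t Z = {v\<in>V. t \<le> 2 * card (links Z v)}"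

lemma finite_rich: "finite (rich t Z)"
  unfolding rich_def using finite_V by simp

text \<open>Double counting of pairs of a vertex \<open>v\<close> and a link \<open>z\<close> of
  \<open>v\<close>: each \<open>z\<close> occurs in at most \<open>card (cols Z Z)\<close> of
  them.\<close>

lemma card_rich_le:
  assumes "Z \<subseteq> V"
  shows "t * card (rich t Z) \<le> 2 * (card Z * card (cols Z Z))"
proof -
  have fZ: "finite Z" using assms finite_V by (rule finite_subset)
  have fD: "finite (cols Z Z)" using fZ by (rule finite_cols[OF _ fZ])
  have "t * card (rich t Z) = (\<Sum>v\<in>rich t Z. t)" by simp
  also have "\<dots> \<le> (\<Sum>v\<in>rich t Z. 2 * card (links Z v))" by (rule sum_mono) (auto simp: rich_def)
  also have "\<dots> \<le> (\<Sum>v\<in>V. 2 * card (links Z v))"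
    by (rule sum_mono2) (use finite_V in \<open>auto simp: rich_def\<close>)
  also have "\<dots> = 2 * (\<Sum>v\<in>V. card {z\<in>Z. v \<noteq> z \<and> d v z \<in> cols Z Z})"
    by (simp add: sum_distrib_left links_def)
  also have "(\<Sum>v\<in>V. card {z\<in>Z. v \<noteq> z \<and> d v z \<in> cols Z Z})
      = (\<Sum>z\<in>Z. card {v\<in>V. v \<noteq> z \<and> d v z \<in> cols Z Z})"
    by (rule sum_multicount_gen) (use finite_V fZ in auto)
  also have "\<dots> \<le> (\<Sum>z\<in>Z. card (cols Z Z))"
    by (rule sum_mono, rule card_color_star_le) (use assms fD in auto)
  finally show ?thesis by simp
qed

text \<open>The edges from \<open>u\<close> to the vertices of \<open>Z\<close> that are not links
  have distinct colours, none of which occurs inside \<open>Z\<close>. A poorly linked vertex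
  therefore forces many new colours.\<close>

lemma card_cols_extend:
  assumes "Z \<subseteq> Z'" "Z' \<subseteq> V" "u \<in> Z' - Z"
  shows "card (cols Z Z) + card Z \<le> card (cols Z' Z') + card (links Z u)"
proof -
  have fZ': "finite Z'" using assms finite_V finite_subset by blast
  have fZ: "finite Z" using assms(1) fZ' finite_subset by blast
  have fD: "finite (cols Z' Z')" using fZ' by (rule finite_cols[OF _ fZ'])
  have sub: "cols Z Z \<subseteq> cols Z' Z'" using assms(1) by (rule cols_mono[OF _ assms(1)])
  let ?N = "Z - links Z u"
  have new: "d u z \<notin> cols Z Z" if "z \<in> ?N" for z
    using that assms(3) unfolding links_def by auto
  have "card (links Z u) + card ?N = card Z"
    using fZ by (subst card_Un_disjoint[symmetric]) (auto simp: links_def intro!: arg_cong[where f=card])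
  moreover have "card (cols Z Z) + card ?N \<le> card (cols Z' Z')"
  proof -
    have "inj_on (d u) ?N" by (rule inj_on_star) (use assms in auto)
    then have "card (cols Z Z) + card ?N = card (cols Z Z) + card (d u ` ?N)" by (simp add: card_image)
    also have "\<dots> = card (cols Z Z \<union> d u ` ?N)"
      using new fZ sub fD by (subst card_Un_disjoint) (auto intro: finite_subset)
    also have "\<dots> \<le> card (cols Z' Z')"
      using sub fD assms by (intro card_mono) (auto intro!: colsI)
    finally show ?thesis .
  qed
  ultimately show ?thesis by linarith
qed

section \<open>Extending a set one vertex at a time\<close>

inductive extends :: "'a set \<Rightarrow> nat \<Rightarrow> 'a set \<Rightarrow> bool" for X where
  extends_0: "extends X 0 X"
| extends_Suc: "\<lbrakk>extends X m Z; v \<in> nbrs Z (cols Z Z); v \<notin> Z\<rbrakk> \<Longrightarrow> extends X (Suc m) (insert v Z)"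

lemma extends_finite: "\<lbrakk>extends X m Z; finite X\<rbrakk> \<Longrightarrow> finite Z"
  by (induction rule: extends.induct) auto

lemma extends_card: "\<lbrakk>extends X m Z; finite X\<rbrakk> \<Longrightarrow> card Z = card X + m"
proof (induction rule: extends.induct)
  case (extends_Suc m Z v)
  then have "finite Z" using extends_finite by blast
  then show ?case using extends_Suc by simp
qed simp

lemma extends_superset: "extends X m Z \<Longrightarrow> X \<subseteq> Z"
  by (induction rule: extends.induct) auto

lemma extends_subset_V: "\<lbrakk>extends X m Z; X \<subseteq> V\<rbrakk> \<Longrightarrow> Z \<subseteq> V"
  by (induction rule: extends.induct) (auto simp: nbrs_def)

lemma extends_Un:
  assumes "finite Y" "extends X m Z" "Y \<subseteq> Z \<union> nbrs Z (cols Z Z)"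
  shows "\<exists>m'. extends X m' (Z \<union> Y)"
  using assms
proof (induction Y rule: finite_induct)
  case empty then show ?case by auto
next
  case (insert y Y)
  then obtain m' where m': "extends X m' (Z \<union> Y)" by auto
  show ?case
  proof (cases "y \<in> Z \<union> Y")
    case True
    then show ?thesis using m' by (auto simp: insert_absorb)
  next
    case False
    have "nbrs Z (cols Z Z) \<subseteq> nbrs (Z \<union> Y) (cols (Z \<union> Y) (Z \<union> Y))"
      by (intro nbrs_mono cols_mono) auto
    then have "y \<in> nbrs (Z \<union> Y) (cols (Z \<union> Y) (Z \<union> Y))" using False insert.prems by auto
    from extends_Suc[OF m' this False] show ?thesis by auto
  qed
qed

text \<open>Each step picks a vertex of \<open>V\<close> among at most
  \<open>card Z * card (cols Z Z) \<le> n ^ 3\<close> candidates.\<close>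

lemma card_extends_le:
  assumes "X \<subseteq> V"
  shows "finite {Z. extends X m Z \<and> card Z \<le> n} \<and> card {Z. extends X m Z \<and> card Z \<le> n} \<le> (n ^ 3) ^ m"
proof (induction m)
  case 0
  have "{Z. extends X 0 Z \<and> card Z \<le> n} \<subseteq> {X}" by (auto elim: extends.cases)
  then show ?case
    using card_mono[of "{X}" "{Z. extends X 0 Z \<and> card Z \<le> n}"] finite_subset[of _ "{X}"] by auto
next
  case (Suc m)
  let ?F = "{Z. extends X m Z \<and> card Z \<le> n}" and ?G = "{Z. extends X (Suc m) Z \<and> card Z \<le> n}"
  let ?U = "\<Union>Z\<in>?F. (\<lambda>v. insert v Z) ` nbrs Z (cols Z Z)"
  have fX: "finite X" using assms finite_V by (rule finite_subset)
  have sub: "?G \<subseteq> ?U"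
  proof
    fix Y assume Y: "Y \<in> ?G"
    then obtain Z v where Z: "extends X m Z" "v \<in> nbrs Z (cols Z Z)" "v \<notin> Z" "Y = insert v Z"
      by (auto elim: extends.cases)
    have "card Z \<le> card Y" using Z extends_finite[OF Z(1) fX] by simp
    then show "Y \<in> ?U" using Y Z by auto
  qed
  have fU: "finite ?U" using Suc finite_nbrs by auto
  have each: "card ((\<lambda>v. insert v Z) ` nbrs Z (cols Z Z)) \<le> n ^ 3" if "Z \<in> ?F" for Z
  proof -
    have ZV: "Z \<subseteq> V" and fZ: "finite Z" and cZ: "card Z \<le> n"
      using that extends_subset_V[OF _ assms] extends_finite[OF _ fX] by auto
    have "card ((\<lambda>v. insert v Z) ` nbrs Z (cols Z Z)) \<le> card (nbrs Z (cols Z Z))"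
      by (rule card_image_le[OF finite_nbrs])
    also have "\<dots> \<le> card Z * card (cols Z Z)" by (rule card_nbrs_le[OF ZV finite_cols[OF fZ fZ]])
    also have "\<dots> \<le> card Z * (card Z * card Z)" by (intro mult_left_mono card_cols_le fZ) simp
    also have "\<dots> \<le> n * (n * n)" by (intro mult_mono cZ) auto
    finally show ?thesis by (simp add: power3_eq_cube)
  qed
  have "card ?G \<le> card ?U" using fU sub by (rule card_mono)
  also have "\<dots> \<le> (\<Sum>Z\<in>?F. card ((\<lambda>v. insert v Z) ` nbrs Z (cols Z Z)))"
    by (rule card_UN_le) (use Suc in auto)
  also have "\<dots> \<le> (\<Sum>Z\<in>?F. n ^ 3)" by (rule sum_mono) (rule each)
  also have "\<dots> \<le> (n ^ 3) ^ m * n ^ 3" using Suc by simp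
  finally show ?case using finite_subset[OF sub fU] by (simp add: mult.commute)
qed

lemma ex_extension_of_card:
  assumes "S \<subseteq> V" "X \<subseteq> S" "gen S X = S" "card X + m \<le> card S"
  shows "\<exists>Z. extends X m Z \<and> Z \<subseteq> S"
  using assms(4)
proof (induction m)
  case 0
  have "extends X 0 X" by (rule extends_0)
  then show ?case using assms(2) by blast
next
  case (Suc m)
  have fX: "finite X" using assms finite_V by (meson finite_subset)
  obtain Z where Z: "extends X m Z" "Z \<subseteq> S" using Suc by auto
  have "card Z < card S" using extends_card[OF Z(1) fX] Suc by simp
  then have "Z \<subset> S" using Z by auto
  then obtain u z a b where u: "u \<in> S - Z" "z \<in> Z" "a \<in> Z" "b \<in> Z" "a \<noteq> b" "d u z = d a b"
    using ex_not_closed[OF assms(3) extends_superset[OF Z(1)]] by metis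
  have "d u z \<in> cols Z Z" unfolding u(6) by (rule colsI[OF u(3-5)])
  then have "u \<in> nbrs Z (cols Z Z)" using assms(1) u(1,2) unfolding nbrs_def by auto
  then have "extends X (Suc m) (insert u Z)" using Z u by (intro extends_Suc) auto
  then show ?case using u Z by auto
qed

text \<open>
  A vertex \<open>u\<close> with few links to \<open>Z\<close> contributes many new colours, which can happen only
  rarely. If such vertices exist but none of them is reachable from \<open>Z\<close>, then, as \<open>S\<close> is
  generated, one of them is reachable after adjoining at most three vertices that are already
  well linked to \<open>Z\<close>.
\<close>
lemma ex_rich_extension:
  assumes S: "S \<subseteq> V" and X: "X \<subseteq> S" "gen S X = S" and i0: "1 \<le> i" "i \<le> card S"
  shows "\<exists>m Z. extends X m Z \<and> Z \<subseteq> S \<and> i \<le> card Z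
    \<and> i * card Z \<le> i * max i (card X) + 8 * card (cols Z Z) \<and> S - Z \<subseteq> rich i Z"
proof -
  \<comment> \<open>Beyond the initial \<open>max i (card X)\<close> vertices, \<open>Z\<close>
    grows in batches of at most four, each containing a poorly linked vertex that brings at least
    \<open>i/2\<close> new colours; hence the coefficient 8.\<close>
  define P where "P Z \<longleftrightarrow> (\<exists>m. extends X m Z) \<and> Z \<subseteq> S \<and> i \<le> card Z
    \<and> i * card Z \<le> i * max i (card X) + 8 * card (cols Z Z)" for Z
  have fS: "finite S" using S finite_V by (rule finite_subset)
  have fX: "finite X" using X(1) fS by (rule finite_subset)
  have cX: "card X \<le> card S" using X fS card_mono by blast
  obtain Z0 where Z0: "extends X (max i (card X) - card X) Z0" "Z0 \<subseteq> S"
    using ex_extension_of_card[OF S X, of "max i (card X) - card X"] cX i0 by auto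
  have "card Z0 = max i (card X)" using extends_card[OF Z0(1) fX] by simp
  then have "P Z0" unfolding P_def using Z0 by auto
  moreover have "\<forall>Z. P Z \<longrightarrow> card Z < Suc (card S)"
    unfolding P_def by (auto simp: less_Suc_eq_le intro: card_mono[OF fS])
  ultimately obtain Z where Z: "P Z" and Zmax: "\<And>Y. P Y \<Longrightarrow> card Y \<le> card Z"
    using ex_has_greatest_nat[of P Z0 card "Suc (card S)"] by auto
  obtain m where m: "extends X m Z" and ZS: "Z \<subseteq> S" and iZ: "i \<le> card Z"
    and bound: "i * card Z \<le> i * max i (card X) + 8 * card (cols Z Z)"
    using Z unfolding P_def by blast
  have fZ: "finite Z" using ZS fS by (rule finite_subset)
  have key: False if u: "u \<in> Z' - Z" "u \<notin> rich i Z" and Z': "Z \<subseteq> Z'" "Z' \<subseteq> S" "extends X m' Z'"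
    "card Z' \<le> card Z + 4" for u Z' m'
  proof -
    have "card (cols Z Z) + card Z \<le> card (cols Z' Z') + card (links Z u)"
      by (rule card_cols_extend) (use u Z' S in auto)
    moreover have "2 * card (links Z u) < i" using u Z' S unfolding rich_def by auto
    ultimately have 1: "8 * card (cols Z Z) + 4 * i \<le> 8 * card (cols Z' Z')" using iZ by linarith
    have "i * card Z' \<le> i * (card Z + 4)" using Z'(4) by (rule mult_left_mono) simp
    also have "\<dots> = i * card Z + 4 * i" by (simp add: algebra_simps)
    finally have "i * card Z' \<le> i * max i (card X) + 8 * card (cols Z' Z')" using bound 1 by linarith
    moreover have fZ': "finite Z'" using Z'(2) fS by (rule finite_subset)
    moreover have "card Z < card Z'" using u Z' fZ' by (intro psubset_card_mono) auto
    ultimately have "P Z'" unfolding P_def using Z' iZ by auto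
    then show False using Zmax \<open>card Z < card Z'\<close> by fastforce
  qed
  have "S - Z \<subseteq> rich i Z"
  proof (rule ccontr)
    assume a: "\<not> ?thesis"
    show False
    proof (cases "\<exists>u\<in>S - Z. u \<notin> rich i Z \<and> links Z u \<noteq> {}")
      case True
      then obtain u where u: "u \<in> S - Z" "u \<notin> rich i Z" "links Z u \<noteq> {}" by auto
      then have "u \<in> nbrs Z (cols Z Z)" using S unfolding nbrs_def links_def by auto
      then have "extends X (Suc m) (insert u Z)" using m u by (intro extends_Suc) auto
      moreover have "card (insert u Z) \<le> card Z + 4" using fZ by (simp add: card_insert_if)
      ultimately show False using key[of u "insert u Z" "Suc m"] u ZS by blast
    next
      case False
      \<comment> \<open>Here no poorly linked vertex has any link to \<open>Z\<close>. The set
        \<open>?W\<close> is not closed, so some poorly linked \<open>u\<close> is reached from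
        three vertices of \<open>?W\<close>, each of which lies in \<open>Z\<close> or is reachable
        from \<open>Z\<close> in one step.\<close>
      let ?W = "Z \<union> (S \<inter> rich i Z)"
      have "?W \<subset> S" using a ZS by auto
      moreover have "X \<subseteq> ?W" using extends_superset[OF m] by auto
      ultimately obtain u z p q where u: "u \<in> S - ?W" "z \<in> ?W" "p \<in> ?W" "q \<in> ?W" "p \<noteq> q" "d u z = d p q"
        using ex_not_closed[OF X(2)] by metis
      have near: "?W \<subseteq> Z \<union> nbrs Z (cols Z Z)"
      proof
        fix w assume w: "w \<in> ?W"
        show "w \<in> Z \<union> nbrs Z (cols Z Z)"
        proof (cases "w \<in> Z")
          case False
          then have "w \<in> rich i Z" using w by auto
          then have "links Z w \<noteq> {}" using i0(1) unfolding rich_def by auto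
          then show ?thesis using w ZS S unfolding nbrs_def links_def by auto
        qed auto
      qed
      let ?Y = "Z \<union> {z, p, q}"
      obtain m' where m': "extends X m' ?Y"
        using extends_Un[OF _ m, of "{z, p, q}"] near u by auto
      have uY: "u \<notin> ?Y" using u by auto
      have "u \<in> nbrs ?Y (cols ?Y ?Y)"
        using u S uY unfolding nbrs_def by (auto intro!: bexI[of _ z] colsI)
      from extends_Suc[OF m' this uY] have ext: "extends X (Suc m') (insert u ?Y)" .
      have "card (insert u ?Y) \<le> card Z + card {u, z, p, q}"
        by (rule order_trans[OF _ card_Un_le]) (auto intro!: card_mono fZ)
      also have "card {u, z, p, q} \<le> 4" by (simp add: card_insert_if)
      finally have "card (insert u ?Y) \<le> card Z + 4" by simp
      moreover have "u \<notin> rich i Z" using u by auto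
      moreover have "insert u ?Y \<subseteq> S" using u ZS by auto
      ultimately show False using key[of u "insert u ?Y" "Suc m'"] ext u by blast
    qed
  qed
  then show ?thesis using m ZS iZ bound by blast
qed

text \<open>A vertex of \<open>S\<close> that is not rich brings at least
  \<open>card (Z \<union> Y) / 2\<close>, hence at least \<open>n/8\<close>, new colours. Since
  \<open>S\<close> spans at most \<open>K * n\<close> colours, at most \<open>8 * K\<close> such
  vertices can be adjoined one after the other.\<close>

lemma ex_rich_completion:
  assumes S: "S \<subseteq> V" and Z: "Z \<subseteq> S" and n: "real (card S) / 4 \<le> real (card Z)" "S \<noteq> {}"
    and K: "real (card (cols S S)) \<le> K * real (card S)"
  shows "\<exists>Y\<subseteq>S. real (card Y) \<le> 8 * K \<and> S - (Z \<union> Y) \<subseteq> rich (card (Z \<union> Y)) (Z \<union> Y)"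
proof -
  have fS: "finite S" using S finite_V by (rule finite_subset)
  have n0: "real (card S) > 0" using n(2) fS by (simp add: card_gt_0_iff)
  define P where "P Y \<longleftrightarrow> Y \<subseteq> S \<and> Y \<inter> Z = {} \<and>
    real (card S) / 8 * real (card Y) \<le> real (card (cols (Z \<union> Y) (Z \<union> Y)))" for Y
  have "P {}" unfolding P_def by simp
  moreover have "\<forall>Y. P Y \<longrightarrow> card Y < Suc (card S)"
    unfolding P_def by (auto simp: less_Suc_eq_le intro: card_mono[OF fS])
  ultimately obtain Y where Y: "P Y" and Ymax: "\<And>Y'. P Y' \<Longrightarrow> card Y' \<le> card Y"
    using ex_has_greatest_nat[of P "{}" card "Suc (card S)"] by auto
  let ?Z = "Z \<union> Y"
  have YS: "Y \<subseteq> S" and disj: "Y \<inter> Z = {}"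
    and bound: "real (card S) / 8 * real (card Y) \<le> real (card (cols ?Z ?Z))"
    using Y unfolding P_def by auto
  have fY: "finite Y" using YS fS by (rule finite_subset)
  have fZ: "finite ?Z" using YS Z fS finite_subset by blast
  have "card (cols ?Z ?Z) \<le> card (cols S S)"
    by (intro card_mono finite_cols cols_mono fS) (use YS Z in auto)
  then have "real (card (cols ?Z ?Z)) \<le> K * real (card S)" using K by linarith
  then have "real (card S) * real (card Y) \<le> 8 * (K * real (card S))" using bound by auto
  then have "real (card S) * real (card Y) \<le> real (card S) * (8 * K)" by (simp add: mult_ac)
  then have "real (card Y) \<le> 8 * K" using n0 by simp
  moreover have "S - ?Z \<subseteq> rich (card ?Z) ?Z"
  proof (rule ccontr)
    assume "\<not> ?thesis"
    then obtain u where u: "u \<in> S - ?Z" "u \<notin> rich (card ?Z) ?Z" by auto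
    have "card (cols ?Z ?Z) + card ?Z \<le> card (cols (insert u ?Z) (insert u ?Z)) + card (links ?Z u)"
      by (rule card_cols_extend) (use u YS Z S in auto)
    moreover have "2 * card (links ?Z u) < card ?Z" using u S unfolding rich_def by auto
    moreover have "card Z \<le> card ?Z" using fZ by (intro card_mono) auto
    ultimately have "real (card (cols ?Z ?Z)) + real (card S) / 8
        \<le> real (card (cols (insert u ?Z) (insert u ?Z)))"
      using n(1) by linarith
    moreover have c: "card (insert u Y) = Suc (card Y)" using u fY by simp
    ultimately have "P (insert u Y)"
      unfolding P_def using u YS disj bound by (auto simp: algebra_simps)
    then show False using Ymax[of "insert u Y"] c by simp
  qed
  ultimately show ?thesis using YS by blast
qed

end

section \<open>Expansion along the colours of a random set\<close>

text \<open>Random vertices are drawn independently and with repetition: the sample space is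
  \<open>PiE I (\<lambda>_. S)\<close> and probabilities are written as cardinalities. This is
  conditioning on all coordinates except \<open>k\<close>.\<close>

lemma sum_PiE_split:
  fixes F :: "_ \<Rightarrow> 'c::comm_monoid_add"
  assumes "k \<in> I"
  shows "(\<Sum>f\<in>PiE I (\<lambda>_. S). F f) = (\<Sum>g\<in>PiE (I - {k}) (\<lambda>_. S). \<Sum>y\<in>S. F (g(k := y)))"
proof -
  have I: "I = insert k (I - {k})" using assms by auto
  have "(\<Sum>f\<in>PiE I (\<lambda>_. S). F f) = sum F ((\<lambda>(y, g). g(k := y)) ` (S \<times> PiE (I - {k}) (\<lambda>_. S)))"
    by (subst I, subst PiE_insert_eq) simp
  also have "\<dots> = (\<Sum>(y, g)\<in>S \<times> PiE (I - {k}) (\<lambda>_. S). F (g(k := y)))"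
    using inj_combinator[of k "I - {k}" "\<lambda>_. S"] by (subst sum.reindex) (auto simp: case_prod_unfold)
  also have "\<dots> = (\<Sum>y\<in>S. \<Sum>g\<in>PiE (I - {k}) (\<lambda>_. S). F (g(k := y)))"
    by (rule sum.cartesian_product[symmetric])
  also have "\<dots> = (\<Sum>g\<in>PiE (I - {k}) (\<lambda>_. S). \<Sum>y\<in>S. F (g(k := y)))"
    by (rule sum.swap)
  finally show ?thesis .
qed

lemma card_Collect_sum: "finite A \<Longrightarrow> card {x\<in>A. P x} = (\<Sum>x\<in>A. of_bool (P x))"
  by (simp add: of_bool_def sum.If_cases Int_def)

lemma card_Collect_times:
  assumes "finite A" "finite B"
  shows "card {p\<in>A \<times> B. P (fst p) (snd p)} = (\<Sum>x\<in>A. card {y\<in>B. P x y})"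
proof -
  have "{p\<in>A \<times> B. P (fst p) (snd p)} = (SIGMA x:A. {y\<in>B. P x y})" by auto
  then show ?thesis using assms by (simp add: card_SigmaI)
qed

lemma card_PiE_split:
  assumes "finite I" "finite S" "k \<in> I"
  shows "card {f\<in>PiE I (\<lambda>_. S). P f} = (\<Sum>g\<in>PiE (I - {k}) (\<lambda>_. S). card {y\<in>S. P (g(k := y))})"
  using assms by (simp add: card_Collect_sum finite_PiE sum_PiE_split[OF assms(3)])

text \<open>Given all coordinates except \<open>k\<close>, the event \<open>P\<close> has
  conditional probability at most \<open>i / card S\<close>, while \<open>R\<close> is already
  determined by these coordinates.\<close>

lemma card_PiE_conj_le:
  assumes fin: "finite I" "finite S" "k \<in> I"
    and P: "\<And>g. g \<in> PiE (I - {k}) (\<lambda>_. S) \<Longrightarrow> card {y\<in>S. P (g(k := y))} \<le> i"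
    and R: "\<And>f y. R (f(k := y)) = R f"
  shows "card S * card {f\<in>PiE I (\<lambda>_. S). P f \<and> R f} \<le> i * card {f\<in>PiE I (\<lambda>_. S). R f}"
proof -
  have le: "card S * card {y\<in>S. P (g(k := y)) \<and> R (g(k := y))} \<le> i * card {y\<in>S. R (g(k := y))}"
    if "g \<in> PiE (I - {k}) (\<lambda>_. S)" for g
    using P[OF that] by (cases "R g") (simp_all add: R mult.commute mult_le_mono)
  show ?thesis
    unfolding card_PiE_split[OF fin] sum_distrib_left by (rule sum_mono) (rule le)
qed

text \<open>Two distinct coordinates form a uniformly distributed pair; the identity is multiplied
  out to avoid division.\<close>

lemma card_PiE_pair:
  assumes fin: "finite I" "finite S" "j \<in> I" "l \<in> I" "j \<noteq> l"
  shows "card S ^ 2 * card {f\<in>PiE I (\<lambda>_. S). P (f j) (f l)}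
    = card S ^ card I * card {p\<in>S \<times> S. P (fst p) (snd p)}"
proof -
  have "card {f\<in>PiE I (\<lambda>_. S). P (f j) (f l)} = (\<Sum>g\<in>PiE (I - {j}) (\<lambda>_. S). card {y\<in>S. P y (g l)})"
    using assms by (subst card_PiE_split[of I S j]) auto
  also have "\<dots> = (\<Sum>g\<in>PiE (I - {j} - {l}) (\<lambda>_. S). \<Sum>y'\<in>S. card {y\<in>S. P y y'})"
    using assms by (subst sum_PiE_split[of l]) auto
  also have "\<dots> = card S ^ card (I - {j} - {l}) * (\<Sum>y'\<in>S. card {y\<in>S. P y y'})"
    using assms by (simp add: card_PiE)
  also have "(\<Sum>y'\<in>S. card {y\<in>S. P y y'}) = (\<Sum>y'\<in>S. \<Sum>y\<in>S. of_bool (P y y'))"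
    using fin by (simp add: card_Collect_sum)
  also have "\<dots> = (\<Sum>y\<in>S. \<Sum>y'\<in>S. of_bool (P y y'))" by (rule sum.swap)
  also have "\<dots> = card {p\<in>S \<times> S. P (fst p) (snd p)}"
    unfolding card_Collect_times[OF fin(2) fin(2)] by (simp only: card_Collect_sum[OF fin(2)] of_nat_id)
  finally have eq: "card {f\<in>PiE I (\<lambda>_. S). P (f j) (f l)}
    = card S ^ card (I - {j} - {l}) * card {p\<in>S \<times> S. P (fst p) (snd p)}" .
  have "card {j, l} \<le> card I" using assms by (intro card_mono) auto
  then have "card I = 2 + card (I - {j} - {l})" using assms by simp
  then show ?thesis unfolding eq by (simp only: power_add mult.assoc)
qed

section \<open>Rare colours and the second moment argument\<close>

context proper_coloring
begin

abbreviation multiplicity :: "'a set \<Rightarrow> 'b \<Rightarrow> nat" where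
  "multiplicity S a \<equiv> card {p\<in>S \<times> S. fst p \<noteq> snd p \<and> d (fst p) (snd p) = a}"

abbreviation rare_star :: "'a set \<Rightarrow> real \<Rightarrow> 'a \<Rightarrow> 'a set" where
  "rare_star S \<theta> v \<equiv> {u\<in>S. v \<noteq> u \<and> real (multiplicity S (d v u)) < \<theta>}"

text \<open>At most \<open>K * n * \<theta> = n^2 / 16\<close> ordered pairs have a rare colour, so
  at most \<open>n/4\<close> vertices are joined to more than \<open>n/4\<close> others by rare
  colours.\<close>

lemma card_nonrare_ge:
  assumes fS: "finite S" and K: "real (card (cols S S)) \<le> K * real (card S)" "K > 0"
  defines "\<theta> \<equiv> real (card S) / (16 * K)"
  shows "real (card {v\<in>S. real (card (rare_star S \<theta> v)) \<le> real (card S) / 4}) \<ge> 3/4 * real (card S)"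
proof (cases "S = {}")
  case False
  let ?n = "real (card S)" and ?C = "cols S S"
  let ?B = "{v\<in>S. \<not> real (card (rare_star S \<theta> v)) \<le> ?n / 4}"
  let ?G = "{v\<in>S. real (card (rare_star S \<theta> v)) \<le> ?n / 4}"
  have n: "?n > 0" using False fS by (simp add: card_gt_0_iff)
  have th: "\<theta> \<ge> 0" unfolding \<theta>_def using K by simp
  let ?R = "{p\<in>S \<times> S. fst p \<noteq> snd p \<and> real (multiplicity S (d (fst p) (snd p))) < \<theta>}"
  have R1: "real (card ?R) \<le> real (card ?C) * \<theta>"
  proof -
    let ?L = "{a\<in>?C. real (multiplicity S a) < \<theta>}"
    have fC: "finite ?C" using fS by (rule finite_cols[OF _ fS])
    have "card ?R \<le> card (\<Union>a\<in>?L. {p\<in>S \<times> S. fst p \<noteq> snd p \<and> d (fst p) (snd p) = a})"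
      by (rule card_mono) (use fS fC in \<open>auto intro: colsI\<close>)
    also have "\<dots> \<le> (\<Sum>a\<in>?L. multiplicity S a)" by (rule card_UN_le) (use fC in auto)
    finally have "real (card ?R) \<le> (\<Sum>a\<in>?L. real (multiplicity S a))"
      unfolding of_nat_sum[symmetric] of_nat_le_iff .
    also have "\<dots> \<le> (\<Sum>a\<in>?L. \<theta>)" by (rule sum_mono) auto
    also have "\<dots> = real (card ?L) * \<theta>" by simp
    also have "\<dots> \<le> real (card ?C) * \<theta>"
      using th fC by (intro mult_right_mono) (auto intro!: card_mono)
    finally show ?thesis .
  qed
  have R2: "card ?R = (\<Sum>v\<in>S. card (rare_star S \<theta> v))"
    by (rule card_Collect_times[OF fS fS])
  have "real (card ?B) * (?n / 4) = (\<Sum>v\<in>?B. ?n / 4)" by simp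
  also have "\<dots> \<le> (\<Sum>v\<in>?B. real (card (rare_star S \<theta> v)))" by (rule sum_mono) auto
  also have "\<dots> \<le> (\<Sum>v\<in>S. real (card (rare_star S \<theta> v)))" by (rule sum_mono2) (use fS in auto)
  also have "\<dots> = real (card ?R)" unfolding R2 by simp
  also have "\<dots> \<le> K * ?n * \<theta>" using R1 mult_right_mono[OF K(1) th] by linarith
  also have "\<dots> = ?n / 16 * ?n" unfolding \<theta>_def using K(2) by simp
  finally have "real (card ?B) * (?n / 4) \<le> ?n / 16 * ?n" .
  moreover have "4 * b \<le> m" if "b * (m / 4) \<le> m / 16 * m" "m > 0" for b m :: real
    using that mult_le_cancel_right_pos[of m "4 * b" m] by auto
  ultimately have "4 * real (card ?B) \<le> ?n" using n by blast
  moreover have "card S = card ?B + card ?G"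
    using fS by (subst card_Un_disjoint[symmetric]) (auto intro!: arg_cong[where f=card])
  ultimately show ?thesis by simp
qed simp

text \<open>Second moment method for \<open>t\<close> random vertices. For fixed \<open>w\<close>,
  the number \<open>X w f\<close> of index pairs whose colour leads from \<open>Z\<close> to
  \<open>w\<close> has second moment at most twice its mean, so \<open>w\<close> is reached with
  probability at least half that mean. The means sum to at least \<open>T * i / (64 * K)\<close>
  over \<open>w\<close>, because most edges at \<open>Z\<close> have a frequent colour.\<close>

lemma ex_expanding_set:
  assumes S: "S \<subseteq> V" and K: "K > 0"
    and S': "S' \<subseteq> S" "real (card S') \<ge> 3/4 * real (card S)"
      "\<And>v. v \<in> S' \<Longrightarrow> real (card (rare_star S (real (card S) / (16 * K)) v)) \<le> real (card S) / 4"
    and Z: "Z \<subseteq> S'" "real (card Z) \<le> real (card S) / 4"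
    and t: "(t choose 2) * card Z \<le> card S"
    and ne: "S \<noteq> {}"
  shows "\<exists>Y\<subseteq>S. finite Y \<and> card Y \<le> t \<and>
    real (t choose 2) * real (card Z) / (128 * K) \<le> real (card ((S' - Z) \<inter> nbrs Z (cols Y Y)))"
proof -
  define n where "n = card S"
  define i where "i = card Z"
  define T where "T = t choose 2"
  define \<theta> where "\<theta> = real n / (16 * K)"
  define W where "W = S' - Z"
  define A where "A w = d w ` Z" for w
  \<comment> \<open>The colour of the pair \<open>y\<close>, \<open>y'\<close> leads from
    \<open>Z\<close> to \<open>w\<close>; \<open>h w\<close> counts such ordered pairs in
    \<open>S\<close>.\<close>
  define \<phi> where "\<phi> w y y' \<longleftrightarrow> y \<noteq> y' \<and> d y y' \<in> A w" for w y y'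
  define h where "h w = card {p\<in>S \<times> S. \<phi> w (fst p) (snd p)}" for w
  let ?F = "PiE {..<t} (\<lambda>_. S)"
  define Pr where "Pr = {(j, l). j < l \<and> l < t}"
  define M where "M w p = card {f\<in>?F. \<phi> w (f (fst p)) (f (snd p))}" for w p
  define X where "X w f = card {p\<in>Pr. \<phi> w (f (fst p)) (f (snd p))}" for w f
  have fS: "finite S" using S finite_V by (rule finite_subset)
  have fS': "finite S'" using S'(1) fS by (rule finite_subset)
  have fZ: "finite Z" using Z(1) fS' by (rule finite_subset)
  have fW: "finite W" unfolding W_def using fS' by simp
  have fF: "finite ?F" using fS by (intro finite_PiE) auto
  have n0: "n > 0" unfolding n_def using ne fS by (simp add: card_gt_0_iff)
  have Pr_sub: "Pr \<subseteq> {..<t} \<times> {..<t}" unfolding Pr_def by auto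
  have fPr: "finite Pr" by (rule finite_subset[OF Pr_sub]) simp
  have cPr: "card Pr = T"
  proof -
    have "bij_betw (\<lambda>(j, l). {j, l}) Pr {B. B \<subseteq> {..<t} \<and> card B = 2}"
      unfolding bij_betw_def
    proof
      show "inj_on (\<lambda>(j, l). {j, l}) Pr"
        unfolding inj_on_def Pr_def by (auto simp: doubleton_eq_iff)
      show "(\<lambda>(j, l). {j, l}) ` Pr = {B. B \<subseteq> {..<t} \<and> card B = 2}"
      proof (rule set_eqI, rule iffI)
        fix B assume "B \<in> {B. B \<subseteq> {..<t} \<and> card B = 2}"
        then obtain x y where B: "B = {x, y}" "x \<noteq> y" "x < t" "y < t"
          by (auto simp: card_2_iff)
        then have "B = (\<lambda>(j, l). {j, l}) (min x y, max x y)" "(min x y, max x y) \<in> Pr"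
          unfolding Pr_def by (auto simp: min_def max_def)
        then show "B \<in> (\<lambda>(j, l). {j, l}) ` Pr" by (rule image_eqI)
      qed (auto simp: Pr_def)
    qed
    then have "card Pr = card {B. B \<subseteq> {..<t} \<and> card B = 2}" by (rule bij_betw_same_card)
    then show ?thesis unfolding T_def by (simp add: n_subsets)
  qed
  have cA: "card (A w) \<le> i" for w unfolding A_def i_def by (rule card_image_le[OF fZ])
  have fA: "finite (A w)" for w unfolding A_def using fZ by simp

  \<comment> \<open>Two distinct index pairs behave almost independently: fixing all other coordinates,
    an index occurring in only one of them has at most \<open>i\<close> admissible values.\<close>
  have pairs: "n * card {f\<in>?F. \<phi> w (f (fst p)) (f (snd p)) \<and> \<phi> w (f (fst q)) (f (snd q))} \<le> i * M w q"
    if p: "p \<in> Pr" and q: "q \<in> Pr" and pq: "p \<noteq> q" for w p q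
  proof -
    have dist: "fst p < snd p" "fst q < snd q" "fst p < t" "snd p < t" using p q unfolding Pr_def by auto
    \<comment> \<open>Both pairs are increasing and they are distinct, so if \<open>fst p\<close>
      occurs in \<open>q\<close>, then \<open>snd p\<close> does not.\<close>
    obtain k where k: "k = fst p \<or> k = snd p" "k \<noteq> fst q" "k \<noteq> snd q"
    proof (cases "fst p \<noteq> fst q \<and> fst p \<noteq> snd q")
      case True then show ?thesis using that by auto
    next
      case False then show ?thesis using that[of "snd p"] pq dist by (auto simp: prod_eq_iff)
    qed
    have star: "card {y\<in>S. \<phi> w y x} \<le> i" "card {y\<in>S. \<phi> w x y} \<le> i" if x: "x \<in> S" for x
    proof -
      have "card {y\<in>S. \<phi> w y x} \<le> card {v\<in>V. v \<noteq> x \<and> d v x \<in> A w}"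
        unfolding \<phi>_def by (rule card_mono) (use finite_V S in auto)
      also have "\<dots> \<le> i" using card_color_star_le[of x "A w"] x S fA cA[of w] by fastforce
      finally show "card {y\<in>S. \<phi> w y x} \<le> i" .
      moreover have "\<phi> w x y = \<phi> w y x" for y unfolding \<phi>_def using d_commute[of x y] by auto
      ultimately show "card {y\<in>S. \<phi> w x y} \<le> i" by simp
    qed
    show ?thesis
      unfolding M_def n_def
    proof (rule card_PiE_conj_le[of _ _ k])
      show "k \<in> {..<t}" using k dist by auto
      fix g assume g: "g \<in> PiE ({..<t} - {k}) (\<lambda>_. S)"
      show "card {y\<in>S. \<phi> w ((g(k := y)) (fst p)) ((g(k := y)) (snd p))} \<le> i"
      proof (cases "k = fst p")
        case True
        then have "g (snd p) \<in> S" using g dist by (intro PiE_mem[OF g]) auto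
        then show ?thesis using star True dist by simp
      next
        case False
        then have "g (fst p) \<in> S" using g dist k by (intro PiE_mem[OF g]) auto
        then show ?thesis using star False k dist by simp
      qed
    qed (use fS k in auto)
  qed
  have M_eq: "n ^ 2 * M w p = n ^ t * h w" if "p \<in> Pr" for w p
    unfolding M_def n_def h_def
    using card_PiE_pair[of "{..<t}" S "fst p" "snd p" "\<phi> w"] that fS unfolding Pr_def by auto
  have h_eq: "h w = (\<Sum>z\<in>Z. multiplicity S (d w z))" if w: "w \<in> W" for w
  proof -
    have wV: "w \<in> V" "w \<notin> Z" using w S S'(1) unfolding W_def by auto
    have inj: "inj_on (d w) Z" by (rule inj_on_star) (use wV Z S' S in auto)
    have "h w = card (\<Union>z\<in>Z. {p\<in>S \<times> S. fst p \<noteq> snd p \<and> d (fst p) (snd p) = d w z})"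
      unfolding h_def \<phi>_def A_def by (rule arg_cong[where f=card]) auto
    also have "\<dots> = (\<Sum>z\<in>Z. multiplicity S (d w z))"
      by (rule card_UN_disjoint) (use fZ fS inj in \<open>auto simp: inj_on_def\<close>)
    finally show ?thesis .
  qed
  have sum_h: "real i * real n ^ 2 / (64 * K) \<le> (\<Sum>w\<in>W. real (h w))"
  proof -
    \<comment> \<open>\<open>W\<close> has at least \<open>n/2\<close> elements and
      \<open>z \<in> S'\<close> has at most \<open>n/4\<close> rare neighbours, so
      \<open>n/4\<close> vertices of \<open>W\<close> contribute at least \<open>\<theta>\<close>
      each.\<close>
    have each: "real n * \<theta> / 4 \<le> (\<Sum>w\<in>W. real (multiplicity S (d w z)))" if z: "z \<in> Z" for z
    proof -
      let ?G = "{w\<in>W. real (multiplicity S (d w z)) \<ge> \<theta>}"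
      have "W - rare_star S \<theta> z \<subseteq> ?G"
        using z S'(1) unfolding W_def by (auto simp: d_commute[of z])
      then have "card W - card (rare_star S \<theta> z) \<le> card ?G"
        using diff_card_le_card_Diff[of "rare_star S \<theta> z" W] fS fW card_mono[of ?G "W - rare_star S \<theta> z"]
        by fastforce
      then have "real (card ?G) \<ge> real (card W) - real (card (rare_star S \<theta> z))" by linarith
      moreover have "real (card (rare_star S \<theta> z)) \<le> real n / 4"
        using S'(3)[of z] z Z unfolding \<theta>_def n_def by auto
      moreover have "card W = card S' - card Z" unfolding W_def using Z fZ by (intro card_Diff_subset) auto
      then have "real (card W) \<ge> real n / 2" using S'(2) Z(2) unfolding n_def by linarith
      ultimately have "real (card ?G) \<ge> real n / 4" by linarith
      then have "real n / 4 * \<theta> \<le> real (card ?G) * \<theta>"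
        using K unfolding \<theta>_def by (intro mult_right_mono) auto
      also have "\<dots> = (\<Sum>w\<in>?G. \<theta>)" by simp
      also have "\<dots> \<le> (\<Sum>w\<in>?G. real (multiplicity S (d w z)))" by (rule sum_mono) auto
      also have "\<dots> \<le> (\<Sum>w\<in>W. real (multiplicity S (d w z)))" by (rule sum_mono2) (use fW in auto)
      finally show ?thesis by simp
    qed
    have "real i * real n ^ 2 / (64 * K) = (\<Sum>z\<in>Z. real n * \<theta> / 4)"
      unfolding \<theta>_def i_def by (simp add: power2_eq_square)
    also have "\<dots> \<le> (\<Sum>z\<in>Z. \<Sum>w\<in>W. real (multiplicity S (d w z)))" by (rule sum_mono) (rule each)
    also have "\<dots> = (\<Sum>w\<in>W. \<Sum>z\<in>Z. real (multiplicity S (d w z)))" by (rule sum.swap)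
    also have "\<dots> = (\<Sum>w\<in>W. real (h w))" by (rule sum.cong) (simp_all add: h_eq)
    finally show ?thesis .
  qed
  define gain where "gain f = card {w\<in>W. X w f \<ge> 1}" for f
  have gain_ge: "2 * real (gain f) \<ge> (\<Sum>w\<in>W. 3 * real (X w f) - real (X w f) ^ 2)" for f
  proof -
    \<comment> \<open>A quadratic lower bound for the indicator of \<open>x \<ge> 1\<close>, with
      equality at 0, 1 and 2.\<close>
    have pt: "3 * real x - real x ^ 2 \<le> 2 * of_bool (x \<ge> 1)" for x :: nat
    proof (cases "x \<le> 2")
      case True
      then have "x = 0 \<or> x = 1 \<or> x = 2" by auto
      then show ?thesis by auto
    next
      case False
      then have "3 * real x \<le> real x * real x" by (intro mult_right_mono) auto
      then show ?thesis by (simp add: power2_eq_square)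
    qed
    have "(\<Sum>w\<in>W. 3 * real (X w f) - real (X w f) ^ 2) \<le> (\<Sum>w\<in>W. 2 * of_bool (X w f \<ge> 1))"
      by (rule sum_mono) (rule pt)
    also have "\<dots> = 2 * real (gain f)"
      unfolding gain_def card_Collect_sum[OF fW] by (simp add: sum_distrib_left)
    finally show ?thesis .
  qed
  have X_sum: "real (X w f) = (\<Sum>p\<in>Pr. of_bool (\<phi> w (f (fst p)) (f (snd p))))" for w f
    unfolding X_def card_Collect_sum[OF fPr] by simp
  have per_w: "real T * real n ^ t * real (h w) \<le> real n ^ 2 * (\<Sum>f\<in>?F. 3 * real (X w f) - real (X w f) ^ 2)"
    for w
  proof -
    have first: "(\<Sum>f\<in>?F. real (X w f)) = (\<Sum>p\<in>Pr. real (M w p))"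
    proof -
      have "(\<Sum>f\<in>?F. real (X w f)) = (\<Sum>p\<in>Pr. \<Sum>f\<in>?F. of_bool (\<phi> w (f (fst p)) (f (snd p))))"
        unfolding X_sum by (rule sum.swap)
      then show ?thesis unfolding M_def card_Collect_sum[OF fF] by simp
    qed
    have "(\<Sum>f\<in>?F. real (X w f) ^ 2) = (\<Sum>f\<in>?F. \<Sum>p\<in>Pr. \<Sum>q\<in>Pr.
        of_bool (\<phi> w (f (fst p)) (f (snd p)) \<and> \<phi> w (f (fst q)) (f (snd q))))"
      unfolding X_sum power2_eq_square sum_product by (simp add: of_bool_conj)
    also have "\<dots> = (\<Sum>p\<in>Pr. \<Sum>f\<in>?F. \<Sum>q\<in>Pr.
        of_bool (\<phi> w (f (fst p)) (f (snd p)) \<and> \<phi> w (f (fst q)) (f (snd q))))"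
      by (rule sum.swap)
    also have "\<dots> = (\<Sum>p\<in>Pr. \<Sum>q\<in>Pr. \<Sum>f\<in>?F.
        of_bool (\<phi> w (f (fst p)) (f (snd p)) \<and> \<phi> w (f (fst q)) (f (snd q))))"
      by (rule sum.cong[OF refl], rule sum.swap)
    also have "\<dots> = (\<Sum>p\<in>Pr. \<Sum>q\<in>Pr. real (card {f\<in>?F. \<phi> w (f (fst p)) (f (snd p)) \<and> \<phi> w (f (fst q)) (f (snd q))}))"
      unfolding card_Collect_sum[OF fF] by simp
    finally have second: "(\<Sum>f\<in>?F. real (X w f) ^ 2) = \<dots>" .
    \<comment> \<open>Off the diagonal this is \<open>pairs\<close>; the diagonal contributes the
      second summand.\<close>
    have "real n * (\<Sum>f\<in>?F. real (X w f) ^ 2)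
        \<le> (\<Sum>p\<in>Pr. \<Sum>q\<in>Pr. real i * real (M w q) + of_bool (p = q) * (real n * real (M w q)))"
      unfolding second sum_distrib_left
    proof (intro sum_mono)
      fix p q assume p: "p \<in> Pr" and q: "q \<in> Pr"
      show "real n * real (card {f\<in>?F. \<phi> w (f (fst p)) (f (snd p)) \<and> \<phi> w (f (fst q)) (f (snd q))})
        \<le> real i * real (M w q) + of_bool (p = q) * (real n * real (M w q))"
      proof (cases "p = q")
        case True
        then show ?thesis unfolding M_def by simp
      next
        case False
        then show ?thesis using pairs[OF p q False, of w]
          by (simp flip: of_nat_mult)
      qed
    qed
    also have "\<dots> = real T * real i * (\<Sum>q\<in>Pr. real (M w q)) + real n * (\<Sum>q\<in>Pr. real (M w q))"
    proof -
      have "(\<Sum>q\<in>Pr. of_bool (p = q) * (real n * real (M w q))) = real n * real (M w p)" if "p \<in> Pr" for p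
      proof -
        have "(\<Sum>q\<in>Pr. of_bool (p = q) * (real n * real (M w q)))
            = (\<Sum>q\<in>Pr. if p = q then real n * real (M w q) else 0)"
          by (rule sum.cong) auto
        then show ?thesis using that fPr by simp
      qed
      then show ?thesis
        by (simp add: sum.distrib cPr sum_distrib_left mult.assoc)
    qed
    also have "\<dots> \<le> real n * (\<Sum>q\<in>Pr. real (M w q)) + real n * (\<Sum>q\<in>Pr. real (M w q))"
    proof -
      \<comment> \<open>The size restriction on \<open>t\<close> makes the off-diagonal part no
        larger than the diagonal one.\<close>
      have "real T * real i \<le> real n" using t unfolding T_def i_def n_def by (simp flip: of_nat_mult)
      then show ?thesis by (intro add_right_mono mult_right_mono) (auto intro: sum_nonneg)
    qed
    finally have "real n * (\<Sum>f\<in>?F. real (X w f) ^ 2) \<le> real n * (2 * (\<Sum>q\<in>Pr. real (M w q)))" by simp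
    then have sq: "(\<Sum>f\<in>?F. real (X w f) ^ 2) \<le> 2 * (\<Sum>q\<in>Pr. real (M w q))" using n0 by simp
    have "real T * real n ^ t * real (h w) = (\<Sum>p\<in>Pr. real n ^ t * real (h w))" by (simp add: cPr)
    also have "\<dots> = (\<Sum>p\<in>Pr. real n ^ 2 * real (M w p))"
      by (rule sum.cong[OF refl]) (metis M_eq of_nat_mult of_nat_power)
    also have "\<dots> = real n ^ 2 * (\<Sum>p\<in>Pr. real (M w p))" by (simp add: sum_distrib_left)
    also have "\<dots> \<le> real n ^ 2 * (\<Sum>f\<in>?F. 3 * real (X w f) - real (X w f) ^ 2)"
    proof (rule mult_left_mono)
      have "(\<Sum>f\<in>?F. 3 * real (X w f) - real (X w f) ^ 2)
          = 3 * (\<Sum>f\<in>?F. real (X w f)) - (\<Sum>f\<in>?F. real (X w f) ^ 2)"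
        by (simp add: sum_subtractf sum_distrib_left)
      then show "(\<Sum>p\<in>Pr. real (M w p)) \<le> (\<Sum>f\<in>?F. 3 * real (X w f) - real (X w f) ^ 2)"
        using first sq by linarith
    qed simp
    finally show ?thesis .
  qed
  have cF: "real (card ?F) = real n ^ t" unfolding n_def by (simp add: card_PiE)
  have avg: "\<exists>f\<in>?F. real T * real i / (128 * K) \<le> real (gain f)"
  proof (rule ccontr)
    assume "\<not> ?thesis"
    then have less: "real (gain f) < real T * real i / (128 * K)" if "f \<in> ?F" for f
      using that by force
    have Fne: "?F \<noteq> {}" using ne by (simp add: PiE_eq_empty_iff)
    have "real T * real n ^ t * (real i * real n ^ 2 / (64 * K)) \<le> real T * real n ^ t * (\<Sum>w\<in>W. real (h w))"
      using sum_h by (intro mult_left_mono) auto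
    also have "\<dots> = (\<Sum>w\<in>W. real T * real n ^ t * real (h w))" by (simp add: sum_distrib_left)
    also have "\<dots> \<le> (\<Sum>w\<in>W. real n ^ 2 * (\<Sum>f\<in>?F. 3 * real (X w f) - real (X w f) ^ 2))"
      by (rule sum_mono) (rule per_w)
    also have "\<dots> = real n ^ 2 * (\<Sum>f\<in>?F. \<Sum>w\<in>W. 3 * real (X w f) - real (X w f) ^ 2)"
      unfolding sum_distrib_left[symmetric] by (subst sum.swap) simp
    also have "\<dots> \<le> real n ^ 2 * (\<Sum>f\<in>?F. 2 * real (gain f))"
      by (intro mult_left_mono sum_mono gain_ge) simp
    also have "\<dots> < real n ^ 2 * (\<Sum>f\<in>?F. 2 * (real T * real i / (128 * K)))"
      using n0 by (intro mult_strict_left_mono sum_strict_mono fF Fne) (auto dest: less)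
    also have "\<dots> = real T * real n ^ t * (real i * real n ^ 2 / (64 * K))"
      using cF by (simp add: mult_ac)
    finally show False by simp
  qed
  then obtain f where f: "f \<in> ?F" "real T * real i / (128 * K) \<le> real (gain f)" by blast
  let ?Y = "f ` {..<t}"
  have "?Y \<subseteq> S" using f(1) by (auto dest: PiE_mem)
  moreover have "card ?Y \<le> t" using card_image_le[of "{..<t}" f] by simp
  moreover have "{w\<in>W. X w f \<ge> 1} \<subseteq> (S' - Z) \<inter> nbrs Z (cols ?Y ?Y)"
  proof
    fix w assume "w \<in> {w\<in>W. X w f \<ge> 1}"
    then have w: "w \<in> W" "X w f \<noteq> 0" by auto
    then obtain p where p: "p \<in> Pr" "\<phi> w (f (fst p)) (f (snd p))"
      unfolding X_def by (metis (mono_tags, lifting) Collect_empty_eq card.empty)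
    have "fst p < t" "snd p < t" using p(1) unfolding Pr_def by auto
    then have "d (f (fst p)) (f (snd p)) \<in> cols ?Y ?Y" using p(2) unfolding \<phi>_def by (intro colsI) auto
    moreover obtain z where "z \<in> Z" "d (f (fst p)) (f (snd p)) = d w z"
      using p(2) unfolding \<phi>_def A_def by auto
    ultimately show "w \<in> (S' - Z) \<inter> nbrs Z (cols ?Y ?Y)"
      using w(1) S S'(1) unfolding W_def nbrs_def by auto
  qed
  then have "gain f \<le> card ((S' - Z) \<inter> nbrs Z (cols ?Y ?Y))"
    unfolding gain_def using fS' by (intro card_mono) auto
  then have "real T * real i / (128 * K) \<le> real (card ((S' - Z) \<inter> nbrs Z (cols ?Y ?Y)))"
    using f(2) by linarith
  ultimately show ?thesis unfolding T_def i_def by blast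
qed

end

section \<open>Weighted counting\<close>

lemma sum_UN_le:
  fixes f :: "'a \<Rightarrow> real"
  assumes "finite I" "\<And>i. i \<in> I \<Longrightarrow> finite (A i)" "\<And>x. f x \<ge> 0"
  shows "sum f (\<Union>i\<in>I. A i) \<le> (\<Sum>i\<in>I. sum f (A i))"
  using assms(1,2)
proof (induction I rule: finite_induct)
  case (insert i I)
  have "sum f (A i \<union> (\<Union>j\<in>I. A j)) + sum f (A i \<inter> (\<Union>j\<in>I. A j)) = sum f (A i) + sum f (\<Union>j\<in>I. A j)"
    by (rule sum.union_inter) (use insert in auto)
  moreover have "sum f (A i \<inter> (\<Union>j\<in>I. A j)) \<ge> 0" using assms(3) by (intro sum_nonneg)
  ultimately show ?case using insert by simp
qed simp

lemma sum_Pow_power_card: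
  fixes x :: real
  assumes "finite C"
  shows "(\<Sum>B\<in>Pow C. x ^ card B) = (1 + x) ^ card C"
  using assms
proof (induction C rule: finite_induct)
  case (insert c C)
  have inj: "inj_on (insert c) (Pow C)" using insert.hyps by (auto simp: inj_on_def)
  have "(\<Sum>B\<in>Pow (insert c C). x ^ card B) = (\<Sum>B\<in>Pow C. x ^ card B) + (\<Sum>B\<in>insert c ` Pow C. x ^ card B)"
    unfolding Pow_insert by (rule sum.union_disjoint) (use insert.hyps in auto)
  also have "(\<Sum>B\<in>insert c ` Pow C. x ^ card B) = (\<Sum>B\<in>Pow C. x * x ^ card B)"
    unfolding sum.reindex[OF inj] comp_def
  proof (rule sum.cong[OF refl])
    fix B assume "B \<in> Pow C"
    then have "finite B" "c \<notin> B" using insert.hyps finite_subset by auto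
    then show "x ^ card (insert c B) = x * x ^ card B" by simp
  qed
  finally show ?case using insert by (simp add: sum_distrib_left[symmetric] algebra_simps)
qed simp

lemma card_subsets_le:
  assumes "finite V"
  shows "card {Y. Y \<subseteq> V \<and> card Y \<le> t} \<le> (card V + 1) ^ t"
proof -
  have "{Y. Y \<subseteq> V \<and> card Y \<le> t} = (\<Union>j\<in>{..t}. {Y. Y \<subseteq> V \<and> card Y = j})" by auto
  then have "card {Y. Y \<subseteq> V \<and> card Y \<le> t} \<le> (\<Sum>j\<in>{..t}. card {Y. Y \<subseteq> V \<and> card Y = j})"
    by (simp add: card_UN_le)
  also have "\<dots> = (\<Sum>j\<in>{..t}. card V choose j)" using assms by (simp add: n_subsets)
  also have "\<dots> \<le> (\<Sum>j\<in>{..t}. (t choose j) * card V ^ j)"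
  proof (rule sum_mono)
    fix j assume "j \<in> {..t}"
    then have "1 \<le> t choose j" by (simp add: Suc_le_eq zero_less_binomial_iff)
    moreover have "card V choose j \<le> card V ^ j"
      by (cases "j \<le> card V") (simp_all add: binomial_le_pow binomial_eq_0)
    ultimately show "card V choose j \<le> (t choose j) * card V ^ j"
      using mult_le_mono[of 1 "t choose j"] by fastforce
  qed
  also have "\<dots> = (card V + 1) ^ t"
    using binomial[of "card V" 1 t] by simp
  finally show ?thesis .
qed

text \<open>The generating function of a family by set size. For a family of \<open>n\<close>-sets,
  \<open>card_eq_weight\<close> recovers the cardinality at the price of
  \<open>(1 / x) ^ n\<close>.\<close>

definition weight :: "real \<Rightarrow> 'a set set \<Rightarrow> real" where
  "weight x F = (\<Sum>Z\<in>F. x ^ card Z)"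

text \<open>
  The bookkeeping device for all counting: with \<open>x\<close> of order \<open>1/K\<close>, adjoining an arbitrary subset
  of \<open>m\<close> candidates multiplies the weight by at most \<open>(1 + x)^m\<close>, without any reference to the
  size of that subset.
\<close>
lemma weight_step:
  fixes base cand :: "'a set \<Rightarrow> 'a set \<Rightarrow> 'a set"
  assumes fV: "finite V" and fF: "finite F" and x: "0 \<le> x" "x \<le> 1"
    and fin: "\<And>Z Y. \<lbrakk>Z \<in> F; Y \<subseteq> V\<rbrakk> \<Longrightarrow> finite (base Z Y) \<and> finite (cand Z Y) \<and> Z \<subseteq> base Z Y"
    and G: "G \<subseteq> {base Z Y \<union> B |Z Y B. Z \<in> F \<and> Y \<subseteq> V \<and> card Y \<le> t \<and>
       real (card (cand Z Y)) \<le> m \<and> B \<subseteq> cand Z Y - base Z Y}"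
    and m: "m \<ge> 0"
  shows "finite G \<and> weight x G \<le> real (card V + 1) ^ t * exp (x * m) * weight x F"
proof -
  let ?Ys = "{Y. Y \<subseteq> V \<and> card Y \<le> t}"
  let ?ok = "\<lambda>Z Y. real (card (cand Z Y)) \<le> m"
  let ?A = "\<lambda>Z Y. if ?ok Z Y then (\<lambda>B. base Z Y \<union> B) ` Pow (cand Z Y - base Z Y) else {}"
  let ?w = "\<lambda>Z :: 'a set. x ^ card Z"
  have fYs: "finite ?Ys" using fV by simp
  have fA: "finite (?A Z Y)" if "Z \<in> F" "Y \<in> ?Ys" for Z Y
  proof -
    have "finite (cand Z Y)" using fin[of Z Y] that by simp
    then show ?thesis by simp
  qed
  have sub: "G \<subseteq> (\<Union>Z\<in>F. \<Union>Y\<in>?Ys. ?A Z Y)"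
  proof
    fix S assume "S \<in> G"
    then obtain Z Y B where *: "S = base Z Y \<union> B" "Z \<in> F" "Y \<in> ?Ys" "?ok Z Y" "B \<subseteq> cand Z Y - base Z Y"
      using G by blast
    then have "S \<in> ?A Z Y" by simp
    then show "S \<in> (\<Union>Z\<in>F. \<Union>Y\<in>?Ys. ?A Z Y)" using *(2,3) by blast
  qed
  have fU: "finite (\<Union>Z\<in>F. \<Union>Y\<in>?Ys. ?A Z Y)" by (intro finite_UN_I fF fYs fA)
  have each: "sum ?w (?A Z Y) \<le> exp (x * m) * ?w Z" if Z: "Z \<in> F" and Y: "Y \<in> ?Ys" for Z Y
  proof (cases "?ok Z Y")
    case True
    let ?b = "base Z Y" and ?C = "cand Z Y - base Z Y"
    have f: "finite ?b" "finite (cand Z Y)" "Z \<subseteq> ?b" using fin[of Z Y] Z Y by auto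
    have inj: "inj_on (\<lambda>B. ?b \<union> B) (Pow ?C)" unfolding inj_on_def by blast
    have "sum ?w (?A Z Y) = (\<Sum>B\<in>Pow ?C. x ^ card (?b \<union> B))"
      using True by (simp add: sum.reindex[OF inj])
    also have "\<dots> = (\<Sum>B\<in>Pow ?C. x ^ card ?b * x ^ card B)"
    proof (rule sum.cong[OF refl])
      fix B assume B: "B \<in> Pow ?C"
      then have "finite B" using f by (auto intro: finite_subset)
      then have "card (?b \<union> B) = card ?b + card B" using B f by (intro card_Un_disjoint) auto
      then show "x ^ card (?b \<union> B) = x ^ card ?b * x ^ card B" by (simp add: power_add)
    qed
    also have "\<dots> = x ^ card ?b * (1 + x) ^ card ?C"
      using f by (simp add: sum_distrib_left[symmetric] sum_Pow_power_card)
    also have "\<dots> \<le> x ^ card Z * exp (x * m)"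
    proof (rule mult_mono)
      \<comment> \<open>As \<open>x \<le> 1\<close>, enlarging \<open>Z\<close> to
        \<open>base Z Y\<close> never raises the weight, so \<open>Y\<close> costs only its number
        of choices.\<close>
      show "x ^ card ?b \<le> x ^ card Z" using f x by (intro power_decreasing card_mono) auto
      have "(1 + x) ^ card ?C \<le> exp x ^ card ?C" using x by (intro power_mono exp_ge_add_one_self) auto
      also have "\<dots> = exp (x * real (card ?C))" by (simp add: exp_of_nat_mult[symmetric] mult.commute)
      also have "card ?C \<le> card (cand Z Y)" using f by (intro card_mono) auto
      then have "exp (x * real (card ?C)) \<le> exp (x * m)"
        using True x by (simp add: mult_left_mono order_trans[of _ "real (card (cand Z Y))"])
      finally show "(1 + x) ^ card ?C \<le> exp (x * m)" .
    qed (use x in auto)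
    finally show ?thesis by (simp add: mult.commute)
  next
    case False
    then show ?thesis using x by simp
  qed
  have "weight x G \<le> sum ?w (\<Union>Z\<in>F. \<Union>Y\<in>?Ys. ?A Z Y)"
    unfolding weight_def using x by (intro sum_mono2[OF fU sub]) auto
  also have "\<dots> \<le> (\<Sum>Z\<in>F. sum ?w (\<Union>Y\<in>?Ys. ?A Z Y))"
    by (intro sum_UN_le finite_UN_I fF fYs fA zero_le_power x(1))
  also have "\<dots> \<le> (\<Sum>Z\<in>F. \<Sum>Y\<in>?Ys. sum ?w (?A Z Y))"
    by (intro sum_mono sum_UN_le fYs fA zero_le_power x(1))
  also have "\<dots> \<le> (\<Sum>Z\<in>F. \<Sum>Y\<in>?Ys. exp (x * m) * ?w Z)" by (intro sum_mono each)
  also have "\<dots> = real (card ?Ys) * (exp (x * m) * weight x F)"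
    unfolding weight_def by (simp add: sum_distrib_left)
  also have "\<dots> \<le> real ((card V + 1) ^ t) * (exp (x * m) * weight x F)"
    using card_subsets_le[OF fV, of t] x
    by (intro mult_right_mono) (auto simp: weight_def simp del: of_nat_power intro!: mult_nonneg_nonneg sum_nonneg)
  finally show ?thesis using finite_subset[OF sub fU] by (simp add: mult.assoc add.commute)
qed

lemma card_eq_weight:
  assumes "finite G" "\<And>S. S \<in> G \<Longrightarrow> card S = n" "x > 0"
  shows "real (card G) = (1 / x) ^ n * weight x G"
proof -
  have "weight x G = (\<Sum>S\<in>G. x ^ n)" unfolding weight_def by (rule sum.cong) (use assms in auto)
  then show ?thesis using assms(3) by (simp add: power_divide)
qed

section \<open>Round-by-round constructions and their weight\<close>

context proper_coloring
begin

text \<open>\<open>s\<close> is the total number of vertices named explicitly (the initial set and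
  the sets \<open>Y\<close>), \<open>k\<close> the number of rounds, and \<open>n\<close> bounds the
  candidates of a round. The adjoined sets \<open>B\<close> are not charged to \<open>s\<close>,
  since the weight pays for them.\<close>

inductive rounds :: "nat \<Rightarrow> nat \<Rightarrow> nat \<Rightarrow> 'a set \<Rightarrow> bool" for n where
  rounds_0: "\<lbrakk>Z \<subseteq> V; card Z \<le> s\<rbrakk> \<Longrightarrow> rounds n s 0 Z"
| rounds_Suc: "\<lbrakk>rounds n s k Z; Y \<subseteq> V; card Y \<le> t; card (nbrs Z (cols Y Y)) \<le> n;
    B \<subseteq> nbrs Z (cols Y Y) - Z\<rbrakk> \<Longrightarrow> rounds n (s + t) (Suc k) (Z \<union> B)"

lemma rounds_subset: "rounds n s k Z \<Longrightarrow> Z \<subseteq> V"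
  by (induction rule: rounds.induct) (auto simp: nbrs_def)

lemma rounds_pad: "\<lbrakk>rounds n s k Z; s \<le> s'\<rbrakk> \<Longrightarrow> rounds n s' (Suc k) Z"
  using rounds_Suc[of n s k Z "{}" "s' - s" "{}"] by (simp add: cols_def nbrs_def)

text \<open>Induction by \<open>weight_step\<close>, with a union over the share \<open>t\<close> of
  the budget \<open>s\<close> spent in the last round. The factor \<open>2 ^ (s + k)\<close> pays
  for these splittings, as the sum of \<open>2 ^ (s - t)\<close> over \<open>t \<le> s\<close> is
  below \<open>2 ^ Suc s\<close>.\<close>

lemma weight_rounds:
  assumes x: "0 \<le> x" "x \<le> 1"
  shows "finite {Z. rounds n s k Z} \<and>
    weight x {Z. rounds n s k Z} \<le> real (card V + 1) ^ s * 2 ^ (s + k) * exp (x * real n * real k)"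
proof (induction k arbitrary: s)
  case 0
  have sub: "{Z. rounds n s 0 Z} \<subseteq> {Y. Y \<subseteq> V \<and> card Y \<le> s}" by (auto elim: rounds.cases)
  have f: "finite {Y. Y \<subseteq> V \<and> card Y \<le> s}" using finite_V by simp
  have "weight x {Z. rounds n s 0 Z} \<le> (\<Sum>Z\<in>{Z. rounds n s 0 Z}. 1)"
    unfolding weight_def by (rule sum_mono) (use x in \<open>auto simp: power_le_one\<close>)
  also have "\<dots> \<le> real (card {Y. Y \<subseteq> V \<and> card Y \<le> s})" using card_mono[OF f sub] by simp
  also have "\<dots> \<le> real ((card V + 1) ^ s)" using card_subsets_le[OF finite_V] of_nat_mono by blast
  also have "\<dots> \<le> real (card V + 1) ^ s * 2 ^ s" by (simp add: mult_le_cancel_left1)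
  finally show ?case using finite_subset[OF sub f] by simp
next
  case (Suc k)
  let ?G = "\<lambda>t. {Z \<union> B |Z Y B. Z \<in> {Z. rounds n (s - t) k Z} \<and> Y \<subseteq> V \<and> card Y \<le> t \<and>
       real (card (nbrs Z (cols Y Y))) \<le> real n \<and> B \<subseteq> nbrs Z (cols Y Y) - Z}"
  let ?E = "exp (x * real n * real k)" and ?N = "real (card V + 1)"
  have G: "finite (?G t) \<and> weight x (?G t) \<le> ?N ^ t * exp (x * real n) * weight x {Z. rounds n (s - t) k Z}" for t
    by (rule weight_step[where base = "\<lambda>Z Y. Z" and cand = "\<lambda>Z Y. nbrs Z (cols Y Y)" and V = V])
      (use Suc x finite_V finite_nbrs finite_subset[OF rounds_subset finite_V] in auto)
  have sub: "{Z. rounds n s (Suc k) Z} \<subseteq> (\<Union>t\<in>{..s}. ?G t)"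
  proof
    fix Z' assume "Z' \<in> {Z. rounds n s (Suc k) Z}"
    then have "rounds n s (Suc k) Z'" by simp
    then obtain s0 t Z Y B where *: "s = s0 + t" "Z' = Z \<union> B" "rounds n s0 k Z" "Y \<subseteq> V" "card Y \<le> t"
      "card (nbrs Z (cols Y Y)) \<le> n" "B \<subseteq> nbrs Z (cols Y Y) - Z"
      by (auto elim: rounds.cases)
    have "t \<in> {..s}" using *(1) by simp
    moreover have "Z' \<in> ?G t" using * by auto
    ultimately show "Z' \<in> (\<Union>t\<in>{..s}. ?G t)" by (rule UN_I)
  qed
  have fU: "finite (\<Union>t\<in>{..s}. ?G t)" using G by blast
  have "weight x {Z. rounds n s (Suc k) Z} \<le> (\<Sum>Z\<in>(\<Union>t\<in>{..s}. ?G t). x ^ card Z)"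
    unfolding weight_def by (intro sum_mono2[OF fU sub]) (use x in auto)
  also have "\<dots> \<le> (\<Sum>t\<in>{..s}. weight x (?G t))"
    unfolding weight_def by (rule sum_UN_le) (use G x in auto)
  also have "\<dots> \<le> (\<Sum>t\<in>{..s}. ?N ^ s * 2 ^ k * exp (x * real n) * ?E * 2 ^ (s - t))"
  proof (rule sum_mono)
    fix t assume t: "t \<in> {..s}"
    have "weight x (?G t) \<le> ?N ^ t * exp (x * real n) * weight x {Z. rounds n (s - t) k Z}" using G by blast
    also have "\<dots> \<le> ?N ^ t * exp (x * real n) * (?N ^ (s - t) * 2 ^ (s - t + k) * ?E)"
      using Suc by (intro mult_left_mono) auto
    also have "\<dots> = ?N ^ (t + (s - t)) * 2 ^ k * exp (x * real n) * ?E * 2 ^ (s - t)"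
      by (simp only: power_add mult_ac)
    finally show "weight x (?G t) \<le> ?N ^ s * 2 ^ k * exp (x * real n) * ?E * 2 ^ (s - t)" using t by simp
  qed
  also have "\<dots> = ?N ^ s * 2 ^ k * exp (x * real n) * ?E * (\<Sum>t\<in>{..s}. 2 ^ (s - t))"
    by (simp add: sum_distrib_left)
  also have "\<dots> \<le> ?N ^ s * 2 ^ k * exp (x * real n) * ?E * 2 ^ Suc s"
  proof (rule mult_left_mono)
    have "(\<Sum>t\<in>{..s}. 2 ^ (s - t)) = (\<Sum>t\<in>{..s}. 2 ^ t :: real)"
      by (rule sum.reindex_bij_witness[of _ "\<lambda>t. s - t" "\<lambda>t. s - t"]) auto
    then show "(\<Sum>t\<in>{..s}. 2 ^ (s - t) :: real) \<le> 2 ^ Suc s"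
      using geometric_sum[of "2::real" "Suc s"] by (simp add: lessThan_Suc_atMost)
  qed simp
  also have "?N ^ s * 2 ^ k * exp (x * real n) * ?E * 2 ^ Suc s
      = ?N ^ s * 2 ^ (s + Suc k) * exp (x * real n * real (Suc k))"
    by (simp add: power_add exp_add[symmetric] algebra_simps)
  finally show ?case using finite_subset[OF sub fU] by blast
qed

end

section \<open>Many colours\<close>

lemma real_choose_two: "real (t choose 2) = real t * (real t - 1) / 2"
proof -
  have "even (t * (t - 1))" by (cases t) auto
  then have "2 * (t choose 2) = t * (t - 1)" unfolding choose_two by (rule dvd_mult_div_cancel)
  then have "2 * real (t choose 2) = real t * real (t - 1)" by (metis of_nat_mult of_nat_numeral)
  then show ?thesis by (cases t) simp_all
qed

text \<open>One step of the estimate that \<open>1 / sqrt j\<close> sums to at most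
  \<open>2 * sqrt k\<close> over \<open>1 \<le> j \<le> k\<close>; it adds up the samples of all
  rounds.\<close>

lemma sqrt_step: "2 * sqrt (real k) + 1 / sqrt (real k + 1) \<le> 2 * sqrt (real k + 1)"
proof -
  let ?a = "sqrt (real k)" and ?b = "sqrt (real k + 1)"
  have ab: "0 \<le> ?a" "?a \<le> ?b" "?b > 0" by auto
  have "1 = (?b + ?a) * (?b - ?a)" by (simp add: algebra_simps)
  also have "\<dots> \<le> (2 * ?b) * (?b - ?a)" using ab by (intro mult_right_mono) auto
  finally have "1 / ?b \<le> 2 * (?b - ?a)" using ab by (simp add: field_simps)
  then show ?thesis by simp
qed

context proper_coloring
begin

text \<open>Idle rounds fill the gap. The inequality \<open>k < k'\<close> is strict because the
  first idle round is what absorbs the surplus budget.\<close>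

lemma rounds_pad_le:
  assumes "rounds n s k Z" "s \<le> s'" "k < k'"
  shows "rounds n s' k' Z"
proof -
  have "rounds n s' (Suc k + j) Z" for j
  proof (induction j)
    case 0 then show ?case using rounds_pad[OF assms(1,2)] by simp
  next
    case (Suc j) then show ?case using rounds_pad[of n s' "Suc k + j" Z s'] by simp
  qed
  from this[of "k' - Suc k"] show ?thesis using assms(3) by simp
qed

text \<open>With \<open>i = card Z\<close> and \<open>t\<close> the integer part of
  \<open>sqrt (n / i)\<close>, at most \<open>t^2 * i \<le> n\<close> candidates arise. As
  \<open>i < n/4\<close> gives \<open>t \<ge> 2\<close>, \<open>t choose 2\<close> is at least
  \<open>n / (16 * i)\<close>, and \<open>ex_expanding_set\<close> gains
  \<open>n / (16 * 128 * K)\<close> vertices.\<close>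

lemma ex_rounds_step:
  fixes K :: real
  assumes S: "S \<subseteq> V" and K: "K > 0"
    and S': "S' \<subseteq> S" "real (card S') \<ge> 3/4 * real (card S)"
      "\<And>v. v \<in> S' \<Longrightarrow> real (card (rare_star S (real (card S) / (16 * K)) v)) \<le> real (card S) / 4"
    and Z: "Z \<subseteq> S'" "Z \<noteq> {}" "real (card Z) < real (card S) / 4"
    and r: "rounds (card S) s k Z"
  shows "\<exists>Z' t. Z' \<subseteq> S' \<and> rounds (card S) (s + t) (Suc k) Z'
    \<and> real t \<le> sqrt (real (card S) / real (card Z))
    \<and> real (card Z) + real (card S) / (2048 * K) \<le> real (card Z')"
proof -
  define n where "n = real (card S)"
  define i where "i = real (card Z)"
  define \<rho> where "\<rho> = sqrt (n / i)"
  define t where "t = nat \<lfloor>\<rho>\<rfloor>"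
  have fS: "finite S" using S finite_V by (rule finite_subset)
  have fS': "finite S'" using S'(1) fS by (rule finite_subset)
  have fZ: "finite Z" using Z(1) fS' by (rule finite_subset)
  have i0: "i > 0" unfolding i_def using Z(2) fZ by (simp add: card_gt_0_iff)
  have "4 * i < n" using Z(3) unfolding i_def n_def by simp
  then have "n / i \<ge> 4" using i0 by (simp add: field_simps)
  then have rho2: "\<rho> \<ge> 2" unfolding \<rho>_def using real_le_rsqrt[of 2 "n / i"] by simp
  have rho_sq: "\<rho> ^ 2 * i = n" unfolding \<rho>_def using \<open>n / i \<ge> 4\<close> i0 by simp
  have "2 \<le> \<lfloor>\<rho>\<rfloor>" using rho2 by (simp add: le_floor_iff)
  then have t_bounds: "real t \<le> \<rho>" "\<rho> - 1 < real t" "2 \<le> real t"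
    unfolding t_def by linarith+
  have t_sq: "real t ^ 2 * i \<le> n"
  proof -
    have "real t ^ 2 \<le> \<rho> ^ 2" using t_bounds by (intro power_mono) auto
    then show ?thesis using i0 rho_sq mult_right_mono[of "real t ^ 2" "\<rho> ^ 2" i] by simp
  qed
  have T_le: "real (t choose 2) \<le> real t ^ 2"
    unfolding real_choose_two using t_bounds by (simp add: power2_eq_square algebra_simps)
  have T_ge: "real (t choose 2) \<ge> \<rho> ^ 2 / 16"
  proof -
    have "(\<rho> / 2) ^ 2 \<le> real t ^ 2" using t_bounds rho2 by (intro power_mono) auto
    moreover have "real t * 2 \<le> real t * real t" using t_bounds by (intro mult_left_mono) auto
    then have "real t ^ 2 / 4 \<le> real (t choose 2)"
      unfolding real_choose_two by (simp add: power2_eq_square algebra_simps)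
    ultimately show ?thesis by (simp add: power_divide)
  qed
  have "real (t choose 2) * i \<le> n" 
    using t_sq mult_right_mono[OF T_le less_imp_le[OF i0]] by linarith
  then have Tn: "(t choose 2) * card Z \<le> card S"
    unfolding i_def n_def of_nat_mult[symmetric] of_nat_le_iff .
  have ne: "S \<noteq> {}" using Z S' by auto
  obtain Y where Y: "Y \<subseteq> S" "finite Y" "card Y \<le> t"
    "real (t choose 2) * real (card Z) / (128 * K) \<le> real (card ((S' - Z) \<inter> nbrs Z (cols Y Y)))"
    using ex_expanding_set[OF S K S' Z(1) less_imp_le[OF Z(3)] Tn ne] by blast
  let ?B = "(S' - Z) \<inter> nbrs Z (cols Y Y)"
  have "real (card (nbrs Z (cols Y Y))) \<le> real (card Z * card (cols Y Y))"
    unfolding of_nat_le_iff by (rule card_nbrs_le) (use Z(1) S'(1) S finite_cols[OF Y(2) Y(2)] in auto)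
  also have "\<dots> \<le> i * real t ^ 2"
  proof -
    have "card (cols Y Y) \<le> card Y * card Y" by (rule card_cols_le[OF Y(2)])
    also have "\<dots> \<le> t * t" using Y(3) by (intro mult_mono) auto
    finally have "real (card (cols Y Y)) \<le> real t ^ 2"
      unfolding power2_eq_square of_nat_mult[symmetric] of_nat_le_iff .
    then show ?thesis unfolding i_def of_nat_mult by (intro mult_left_mono) auto
  qed
  also have "\<dots> \<le> n" using t_sq by (simp add: mult.commute)
  finally have "card (nbrs Z (cols Y Y)) \<le> card S" unfolding n_def by simp
  then have rounds: "rounds (card S) (s + t) (Suc k) (Z \<union> ?B)"
    using r Y S by (intro rounds_Suc) auto
  have "n / (2048 * K) = \<rho> ^ 2 / 16 * i / (128 * K)" unfolding rho_sq[symmetric] by simp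
  also have "\<dots> \<le> real (t choose 2) * i / (128 * K)"
    using T_ge i0 K by (intro divide_right_mono mult_right_mono) auto
  finally have "n / (2048 * K) \<le> real (card ?B)" using Y(4) unfolding i_def by linarith
  moreover have "card (Z \<union> ?B) = card Z + card ?B" using fZ fS' by (intro card_Un_disjoint) auto
  ultimately have "real (card Z) + n / (2048 * K) \<le> real (card (Z \<union> ?B))" by simp
  moreover have "Z \<union> ?B \<subseteq> S'" using Z(1) by auto
  ultimately show ?thesis using rounds t_bounds(1) unfolding n_def i_def \<rho>_def by blast
qed

text \<open>Each round gains \<open>\<gamma>\<close> vertices until \<open>n/4\<close> is reached,
  so round \<open>k + 1\<close> starts from at least \<open>(k + 1) * \<gamma>\<close> vertices and
  samples at most \<open>sqrt (2048 * K / (k + 1))\<close>. Over \<open>O(K)\<close> rounds these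
  samples sum to \<open>O(K)\<close>.\<close>

lemma ex_rounds:
  fixes K :: real
  assumes S: "S \<subseteq> V" and K: "real (card (cols S S)) \<le> K * real (card S)" "K \<ge> 1/2"
    and n: "8 * K < real (card S)" "real (card S) \<le> K\<^sup>2"
  shows "\<exists>Z\<subseteq>S. rounds (card S) (nat \<lceil>5000 * K\<rceil>) (nat \<lceil>516 * K\<rceil>) Z \<and> real (card S) / 4 \<le> real (card Z)"
proof -
  define n where "n = real (card S)"
  define \<gamma> where "\<gamma> = n / (2048 * K)"
  have fS: "finite S" using S finite_V by (rule finite_subset)
  have n0: "n > 0" using n K unfolding n_def by linarith
  have g0: "\<gamma> > 0" unfolding \<gamma>_def using n0 K by simp
  define S' where "S' = {v\<in>S. real (card (rare_star S (n / (16 * K)) v)) \<le> n / 4}"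
  have S': "S' \<subseteq> S" "real (card S') \<ge> 3/4 * real (card S)"
      "\<And>v. v \<in> S' \<Longrightarrow> real (card (rare_star S (real (card S) / (16 * K)) v)) \<le> real (card S) / 4"
    using card_nonrare_ge[OF fS K(1)] K(2) unfolding S'_def n_def by auto
  have inv: "\<exists>Z s. Z \<subseteq> S' \<and> rounds (card S) s k Z \<and> real s \<le> K + 1 + 2 * sqrt (2048 * K) * sqrt (real k)
      \<and> (n / 4 \<le> real (card Z) \<or> (real k + 1) * \<gamma> \<le> real (card Z))" for k
  proof (induction k)
    case 0
    have "nat \<lceil>K\<rceil> \<le> card S'"
      using S'(2) n K(2) unfolding n_def by linarith
    then obtain Z where Z: "Z \<subseteq> S'" "card Z = nat \<lceil>K\<rceil>" by (meson obtain_subset_with_card_n)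
    \<comment> \<open>This is where \<open>n \<le> K^2\<close> enters: about \<open>K\<close>
      initial vertices already match the gain of one round.\<close>
    have "\<gamma> \<le> K\<^sup>2 / (2048 * K)" unfolding \<gamma>_def n_def using n K by (intro divide_right_mono) auto
    also have "\<dots> \<le> K" using K by (simp add: power2_eq_square)
    also have "\<dots> \<le> real (card Z)" using Z by (simp add: real_nat_ceiling_ge)
    finally have "\<gamma> \<le> real (card Z)" .
    moreover have "rounds (card S) (nat \<lceil>K\<rceil>) 0 Z" using Z S' S by (intro rounds_0) auto
    moreover have "real (nat \<lceil>K\<rceil>) \<le> K + 1" using K by linarith
    ultimately show ?case using Z by (intro exI[of _ Z] exI[of _ "nat \<lceil>K\<rceil>"]) auto
  next
    case (Suc k)
    then obtain Z s where Z: "Z \<subseteq> S'" "rounds (card S) s k Z"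
        "real s \<le> K + 1 + 2 * sqrt (2048 * K) * sqrt (real k)"
      and large: "n / 4 \<le> real (card Z) \<or> (real k + 1) * \<gamma> \<le> real (card Z)" by blast
    show ?case
    proof (cases "n / 4 \<le> real (card Z)")
      case True
      have "2 * sqrt (2048 * K) * sqrt (real k) \<le> 2 * sqrt (2048 * K) * sqrt (real (Suc k))"
        using K by (intro mult_left_mono) auto
      then show ?thesis using True Z rounds_pad[OF Z(2) order_refl] by (intro exI[of _ Z] exI[of _ s]) auto
    next
      case False
      then have i: "(real k + 1) * \<gamma> \<le> real (card Z)" using large by simp
      moreover have kg: "(real k + 1) * \<gamma> > 0" using g0 by simp
      ultimately have pos: "real (card Z) > 0" by linarith
      then have "Z \<noteq> {}" by auto
      then obtain Z' t where Z': "Z' \<subseteq> S'" "rounds (card S) (s + t) (Suc k) Z'"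
          "real t \<le> sqrt (n / real (card Z))" "real (card Z) + \<gamma> \<le> real (card Z')"
        using ex_rounds_step[OF S _ S' Z(1) _ _ Z(2)] False K(2) unfolding n_def \<gamma>_def by auto
      have "n / real (card Z) \<le> n / ((real k + 1) * \<gamma>)"
        by (rule divide_left_mono[OF i _ mult_pos_pos[OF pos kg]]) (use n0 in simp)
      also have "\<dots> = 2048 * K / (real k + 1)"
      proof -
        have "real k + 1 \<noteq> 0" "K \<noteq> 0" using K(2) by auto
        then have "n = 2048 * K / (real k + 1) * ((real k + 1) * \<gamma>)" unfolding \<gamma>_def by simp
        then show ?thesis using kg by (subst nonzero_divide_eq_eq) auto
      qed
      finally have "sqrt (n / real (card Z)) \<le> sqrt (2048 * K / (real k + 1))" by simp
      then have "real t \<le> sqrt (2048 * K) * (1 / sqrt (real k + 1))"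
        using Z'(3) by (simp add: real_sqrt_divide)
      then have "real (s + t) \<le> K + 1 + sqrt (2048 * K) * (2 * sqrt (real k) + 1 / sqrt (real k + 1))"
        using Z(3) by (simp add: algebra_simps)
      also have "\<dots> \<le> K + 1 + sqrt (2048 * K) * (2 * sqrt (real k + 1))"
        using sqrt_step[of k] K by (intro add_left_mono mult_left_mono) auto
      finally have "real (s + t) \<le> K + 1 + 2 * sqrt (2048 * K) * sqrt (real (Suc k))"
        by (simp add: algebra_simps)
      moreover have "(real (Suc k) + 1) * \<gamma> \<le> real (card Z')" using i Z'(4) by (simp add: algebra_simps)
      ultimately show ?thesis using Z' by blast
    qed
  qed
  \<comment> \<open>Chosen so that \<open>512 * K * \<gamma> = n / 4\<close>.\<close>
  let ?k = "nat \<lceil>512 * K\<rceil>"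
  have k: "512 * K \<le> real ?k" "real ?k \<le> 512 * K + 1" using K by linarith+
  obtain Z s where Z: "Z \<subseteq> S'" "rounds (card S) s ?k Z"
      "real s \<le> K + 1 + 2 * sqrt (2048 * K) * sqrt (real ?k)"
    and large: "n / 4 \<le> real (card Z) \<or> (real ?k + 1) * \<gamma> \<le> real (card Z)" using inv by blast
  have "n / 4 = 512 * K * \<gamma>" unfolding \<gamma>_def using K by simp
  also have "\<dots> \<le> (real ?k + 1) * \<gamma>" using k g0 by (intro mult_right_mono) auto
  finally have "n / 4 \<le> real (card Z)" using large by auto
  moreover have "rounds (card S) (nat \<lceil>5000 * K\<rceil>) (nat \<lceil>516 * K\<rceil>) Z"
  proof (rule rounds_pad_le[OF Z(2)])
    have "real ?k \<le> 2048 * K" using k K by linarith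
    then have "sqrt (real ?k) \<le> sqrt (2048 * K)" by (rule real_sqrt_le_mono)
    then have "2 * sqrt (2048 * K) * sqrt (real ?k) \<le> 2 * sqrt (2048 * K) * sqrt (2048 * K)"
      using K by (intro mult_left_mono) auto
    also have "\<dots> = 4096 * K" using K by simp
    finally show "s \<le> nat \<lceil>5000 * K\<rceil>" using Z(3) K by linarith
    show "?k < nat \<lceil>516 * K\<rceil>" using k K by linarith
  qed
  ultimately show ?thesis using Z(1) S' unfolding n_def by blast
qed

text \<open>With the threshold equal to \<open>card Z\<close>, the factor \<open>card Z\<close> in
  \<open>card_rich_le\<close> cancels.\<close>

lemma card_rich_self_le:
  assumes "Z \<subseteq> S" "S \<subseteq> V" "Z \<noteq> {}" "real (card (cols S S)) \<le> M"
  shows "real (card (rich (card Z) Z)) \<le> 2 * M"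
proof -
  have fS: "finite S" using assms(2) finite_V by (rule finite_subset)
  have fZ: "finite Z" using assms(1) fS by (rule finite_subset)
  have "card Z * card (rich (card Z) Z) \<le> card Z * (2 * card (cols Z Z))"
    using card_rich_le[of Z "card Z"] assms by (simp add: mult_ac)
  then have "card (rich (card Z) Z) \<le> 2 * card (cols Z Z)" using assms(3) fZ by (simp add: card_gt_0_iff)
  moreover have "card (cols Z Z) \<le> card (cols S S)"
    using assms(1) by (intro card_mono finite_cols cols_mono fS) auto
  ultimately show ?thesis using assms(4) by linarith
qed

text \<open>\<open>S\<close> is described by the set from \<open>ex_rounds\<close>, at most
  \<open>8 * K\<close> vertices from \<open>ex_rich_completion\<close>, and a subset of the rich
  vertices. With \<open>x = 1 / (2 * K)\<close>, the \<open>O(n)\<close> candidates in each of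
  \<open>O(K)\<close> rounds and the \<open>2 * K * n\<close> rich candidates together cost only
  \<open>exp (260 * n)\<close>.\<close>

lemma count_large_K:
  fixes K :: real
  assumes K: "K \<ge> 1/2" and n: "8 * K < real n" "real n \<le> K\<^sup>2"
  shows "real (card {S. S \<subseteq> V \<and> card S = n \<and> real (card (cols S S)) \<le> K * real n})
    \<le> (2 * K) ^ n * exp (260 * real n) * real (card V + 1) ^ nat \<lceil>5020 * K\<rceil> * 2 ^ nat \<lceil>5530 * K\<rceil>"
proof -
  define x where "x = 1 / (2 * K)"
  let ?s = "nat \<lceil>5000 * K\<rceil>" and ?k = "nat \<lceil>516 * K\<rceil>" and ?e = "nat \<lfloor>8 * K\<rfloor>" and ?N = "real (card V + 1)"
  let ?G = "{S. S \<subseteq> V \<and> card S = n \<and> real (card (cols S S)) \<le> K * real n}"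
  let ?F = "{Z. rounds n ?s ?k Z}"
  let ?cand = "\<lambda>Z Y. rich (card (Z \<union> Y)) (Z \<union> Y)"
  have x: "0 < x" "x \<le> 1" unfolding x_def using K by auto
  have W: "finite ?F" "weight x ?F \<le> ?N ^ ?s * 2 ^ (?s + ?k) * exp (x * real n * real ?k)"
    using weight_rounds[of x n ?s ?k] x by auto
  have n0: "n > 0" using n K by (cases n) auto
  have sub: "?G \<subseteq> {(Z \<union> Y) \<union> B |Z Y B. Z \<in> ?F \<and> Y \<subseteq> V \<and> card Y \<le> ?e \<and>
      real (card (?cand Z Y)) \<le> 2 * (K * real n) \<and> B \<subseteq> ?cand Z Y - (Z \<union> Y)}"
  proof
    fix S assume "S \<in> ?G"
    then have S: "S \<subseteq> V" "card S = n" "real (card (cols S S)) \<le> K * real (card S)" by auto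
    have ne: "S \<noteq> {}" using S(2) n0 by auto
    obtain Z where Z: "Z \<subseteq> S" "rounds n ?s ?k Z" "real (card S) / 4 \<le> real (card Z)"
      using ex_rounds[OF S(1,3) K] n S(2) by auto
    obtain Y where Y: "Y \<subseteq> S" "real (card Y) \<le> 8 * K" "S - (Z \<union> Y) \<subseteq> ?cand Z Y"
      using ex_rich_completion[OF S(1) Z(1,3) ne S(3)] by blast
    have "Z \<noteq> {}" using Z(3) S(2) n0 by auto
    then have "real (card (?cand Z Y)) \<le> 2 * (K * real n)"
      using card_rich_self_le[of "Z \<union> Y" S "K * real n"] Z(1) Y(1) S by auto
    moreover have "card Y \<le> ?e" using Y(2) by linarith
    moreover have "S = (Z \<union> Y) \<union> (S - (Z \<union> Y))" using Z Y by auto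
    moreover have "Y \<subseteq> V" using Y S by auto
    moreover have "S - (Z \<union> Y) \<subseteq> ?cand Z Y - (Z \<union> Y)" using Y(3) by auto
    ultimately show "S \<in> {(Z \<union> Y) \<union> B |Z Y B. Z \<in> ?F \<and> Y \<subseteq> V \<and> card Y \<le> ?e \<and>
      real (card (?cand Z Y)) \<le> 2 * (K * real n) \<and> B \<subseteq> ?cand Z Y - (Z \<union> Y)}"
      using Z(2) by blast
  qed
  have G: "finite ?G \<and> weight x ?G \<le> ?N ^ ?e * exp (x * (2 * (K * real n))) * weight x ?F"
  proof (rule weight_step[OF finite_V W(1) less_imp_le[OF x(1)] x(2) _ sub])
    fix Z Y assume "Z \<in> ?F" "Y \<subseteq> V"
    then have "Z \<union> Y \<subseteq> V" using rounds_subset by blast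
    then show "finite (Z \<union> Y) \<and> finite (?cand Z Y) \<and> Z \<subseteq> Z \<union> Y"
      using finite_subset[OF _ finite_V] finite_rich by auto
  qed (use K in simp)
  have "real (card ?G) = (1 / x) ^ n * weight x ?G"
    by (rule card_eq_weight) (use G x in auto)
  then have "real (card ?G) = (2 * K) ^ n * weight x ?G" unfolding x_def by simp
  also have "\<dots> \<le> (2 * K) ^ n * (?N ^ ?e * exp (x * (2 * (K * real n))) * weight x ?F)"
    using G K by (intro mult_left_mono) auto
  also have "\<dots> \<le> (2 * K) ^ n * (?N ^ ?e * exp (x * (2 * (K * real n))) *
      (?N ^ ?s * 2 ^ (?s + ?k) * exp (x * real n * real ?k)))"
    using W(2) K by (intro mult_left_mono) auto
  also have "\<dots> = (2 * K) ^ n * exp (x * (2 * (K * real n)) + x * real n * real ?k) * ?N ^ (?e + ?s) * 2 ^ (?s + ?k)"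
    by (simp only: power_add exp_add mult_ac)
  also have "\<dots> \<le> (2 * K) ^ n * exp (260 * real n) * ?N ^ nat \<lceil>5020 * K\<rceil> * 2 ^ nat \<lceil>5530 * K\<rceil>"
  proof (intro mult_mono mult_left_mono power_increasing)
    have "real ?k \<le> 518 * K" using K by linarith
    then have "x * real ?k \<le> 259" unfolding x_def using K by (simp add: field_simps)
    then have "(x * real ?k) * real n \<le> 259 * real n" by (rule mult_right_mono) simp
    moreover have "x * (2 * (K * real n)) = real n" unfolding x_def using K by simp
    moreover have "x * real n * real ?k = (x * real ?k) * real n" by simp
    ultimately have "x * (2 * (K * real n)) + x * real n * real ?k \<le> 260 * real n" by linarith
    then show "exp (x * (2 * (K * real n)) + x * real n * real ?k) \<le> exp (260 * real n)" by simp
    show "?e + ?s \<le> nat \<lceil>5020 * K\<rceil>" using K by linarith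
    show "?s + ?k \<le> nat \<lceil>5530 * K\<rceil>" using K by linarith
  qed (use K in auto)
  finally show ?thesis .
qed

end

section \<open>Few colours\<close>

lemma ln_le_fourth_root:
  assumes "n \<ge> (1::real)"
  obtains a where "a \<ge> 1" "a ^ 4 = n" "ln n \<le> 4 * a"
proof
  let ?a = "sqrt (sqrt n)"
  show a1: "?a \<ge> 1" using assms by simp
  have sq: "?a ^ 2 = sqrt n" "sqrt n ^ 2 = n" using assms by simp_all
  show a4: "?a ^ 4 = n"
    using power_mult[of ?a 2 2] sq by simp
  have "ln n = 4 * ln ?a" using a4 a1 ln_realpow[of ?a 4] by simp
  also have "\<dots> \<le> 4 * ?a" using ln_bound[of ?a] a1 by simp
  finally show "ln n \<le> 4 * ?a" .
qed

lemma log_16_15_le: "n \<ge> 1 \<Longrightarrow> log (16/15) n \<le> 16 * ln n"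
proof -
  assume n: "n \<ge> 1"
  have "ln (15/16 :: real) \<le> 15/16 - 1" by (rule ln_le_minus_one) simp
  then have "ln (16/15 :: real) \<ge> 1/16" using ln_inverse[of "16/15::real"] by simp
  then have "ln n / ln (16/15) \<le> ln n / (1/16)" using n by (intro divide_left_mono) auto
  then show ?thesis by (simp add: log_def)
qed

context proper_coloring
begin

text \<open>The choice \<open>i = sqrt (K * n)\<close>, rounded up, balances the two costs: the
  \<open>K * n\<close> colours pay for \<open>O(i)\<close> extension steps. Moreover
  \<open>K\<close> and \<open>ln n\<close> are \<open>O(i)\<close>, hence so is
  \<open>card Z\<close>, and the factor \<open>i\<close> cancels in
  \<open>card_rich_le\<close>.\<close>

lemma ex_rich_extension_bounds:
  fixes K :: real
  assumes S: "S \<subseteq> V" "card S = n" and K: "real (card (cols S S)) \<le> K * real n" "K \<ge> 1/2"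
    and n: "8 * K < real n"
  defines "i \<equiv> nat \<lceil>sqrt (K * real n)\<rceil>"
  shows "\<exists>X Z m. X \<subseteq> V \<and> real (card X) \<le> 1 + 14 * K + 16 * ln (real n) \<and> m \<le> 9 * i \<and> extends X m Z \<and> Z \<subseteq> S
    \<and> S - Z \<subseteq> rich i Z \<and> real (card (rich i Z)) \<le> 176 * (K * real n)"
proof -
  have n0: "real n \<ge> 1" "real n > 0" using n K by linarith+
  have fS: "finite S" using S(1) finite_V by (rule finite_subset)
  have ne: "S \<noteq> {}" using n0 S(2) by auto
  have iK: "sqrt (K * real n) \<le> real i" unfolding i_def by (rule real_nat_ceiling_ge)
  have Kn_sq: "K * real n \<le> real i ^ 2" using iK K n0 by (simp add: sqrt_le_D)
  have K_le: "K \<le> real i"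
  proof -
    have "K\<^sup>2 \<le> K * real n" unfolding power2_eq_square using n K by (intro mult_left_mono) auto
    then have "K \<le> sqrt (K * real n)" by (rule real_le_rsqrt)
    then show ?thesis using iK by linarith
  qed
  have i1: "1 \<le> i"
  proof (rule ccontr)
    assume "\<not> 1 \<le> i"
    then have "i = 0" by simp
    then show False using K_le K by simp
  qed
  have "K * real n \<le> real n * real n" using n K n0 by (intro mult_right_mono) auto
  then have "sqrt (K * real n) \<le> real n" using n0 by (intro real_le_lsqrt) (auto simp: power2_eq_square)
  then have i_le: "i \<le> card S" unfolding i_def S(2) by (simp add: nat_le_iff ceiling_le_iff)
  have ln_le: "ln (real n) \<le> 4 * real i"
  proof -
    have "real n \<le> 4 * (K * real n)" using K n0 by (simp add: mult_le_cancel_right)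
    then have "sqrt (real n) \<le> sqrt (4 * (K * real n))" by (rule real_sqrt_le_mono)
    also have "\<dots> = 2 * sqrt (K * real n)" by (simp add: real_sqrt_mult)
    finally have "sqrt (real n) \<le> 2 * real i" using iK by linarith
    moreover have "ln (real n) = 2 * ln (sqrt (real n))" using n0 by (simp add: ln_sqrt)
    moreover have "ln (sqrt (real n)) \<le> sqrt (real n)" using n0 by (intro ln_bound) auto
    ultimately show ?thesis by linarith
  qed
  obtain X where X: "X \<subseteq> S" "real (card X) \<le> 1 + 14 * K + log (16/15) (real (card S))" "gen S X = S"
    using ex_generators[OF S(1) ne _ K(2)] K(1) S(2) by auto
  have cX: "real (card X) \<le> 1 + 14 * K + 16 * ln (real n)"
    using X(2) log_16_15_le[OF n0(1)] S(2) by simp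
  have cXi: "real (card X) \<le> 79 * real i" using cX K_le ln_le i1 by linarith
  obtain m Z where Z: "extends X m Z" "Z \<subseteq> S" "i \<le> card Z"
      "i * card Z \<le> i * max i (card X) + 8 * card (cols Z Z)" "S - Z \<subseteq> rich i Z"
    using ex_rich_extension[OF S(1) X(1,3) i1 i_le] by auto
  have cols_le: "real (card (cols Z Z)) \<le> K * real n"
    using K(1) card_mono[OF finite_cols[OF fS fS] cols_mono[OF Z(2) Z(2)]] by linarith
  have cZ: "card Z \<le> card X + 9 * i"
  proof -
    have "real (card (cols Z Z)) \<le> real (i ^ 2)" unfolding of_nat_power using cols_le Kn_sq by linarith
    then have "card (cols Z Z) \<le> i ^ 2" unfolding of_nat_le_iff .
    then have "i * card Z \<le> i * (max i (card X) + 8 * i)"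
      using Z(4) by (simp add: algebra_simps power2_eq_square)
    then have "card Z \<le> max i (card X) + 8 * i" using i1 by simp
    then show ?thesis by linarith
  qed
  have "finite X" using X(1) fS by (rule finite_subset)
  then have m: "m \<le> 9 * i" using extends_card[OF Z(1)] cZ by simp
  have "real i * real (card (rich i Z)) \<le> 2 * (real (card Z) * real (card (cols Z Z)))"
    using card_rich_le[of Z i] Z(2) S(1) by (simp flip: of_nat_mult add: order_trans)
  also have "\<dots> \<le> 2 * ((88 * real i) * (K * real n))"
    using cZ cXi cols_le by (intro mult_left_mono mult_mono) auto
  finally have "real i * real (card (rich i Z)) \<le> real i * (176 * (K * real n))" by simp
  then have "real (card (rich i Z)) \<le> 176 * (K * real n)" using i1 by simp
  then show ?thesis using X(1) S(1) cX m Z by blast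
qed

text \<open>\<open>S\<close> is described by its generators \<open>X\<close>, the extension from
  \<open>X\<close> to \<open>Z\<close>, and a subset of \<open>rich i Z\<close>. Only
  \<open>X\<close> costs powers of the number of vertices; the other two cost
  \<open>exp (240 * n)\<close> and \<open>exp (88 * n)\<close>.\<close>

lemma count_small_K:
  fixes K :: real
  assumes K: "K \<ge> 1/2" and n: "8 * K < real n" "K\<^sup>2 \<le> real n"
  shows "real (card {S. S \<subseteq> V \<and> card S = n \<and> real (card (cols S S)) \<le> K * real n})
    \<le> (2 * K) ^ n * exp (330 * real n) * real (card V + 1) ^ nat \<lfloor>1 + 14 * K + 16 * ln (real n)\<rfloor>"
proof -
  define x where "x = 1 / (2 * K)"
  define i where "i = nat \<lceil>sqrt (K * real n)\<rceil>"
  let ?s = "nat \<lfloor>1 + 14 * K + 16 * ln (real n)\<rfloor>" and ?N = "real (card V + 1)" and ?M = "9 * i"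
  let ?G = "{S. S \<subseteq> V \<and> card S = n \<and> real (card (cols S S)) \<le> K * real n}"
  let ?Xs = "{X. X \<subseteq> V \<and> card X \<le> ?s}"
  let ?E = "\<lambda>X m. {Z. extends X m Z \<and> card Z \<le> n}"
  let ?F = "\<Union>X\<in>?Xs. \<Union>m\<in>{..?M}. ?E X m"
  have x: "0 < x" "x \<le> 1" unfolding x_def using K by auto
  have n0: "real n \<ge> 1" using n K by linarith
  have fXs: "finite ?Xs" using finite_V by simp
  have E: "finite (?E X m)" "card (?E X m) \<le> (n ^ 3) ^ m" if "X \<in> ?Xs" for X m
    using card_extends_le[of X m n] that by auto
  have fF: "finite ?F" by (intro finite_UN_I fXs E(1)) auto
  have F_sub: "Z \<subseteq> V" if "Z \<in> ?F" for Z using that extends_subset_V by auto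
  have cF: "card ?F \<le> (card V + 1) ^ ?s * ((?M + 1) * (n ^ 3) ^ ?M)"
  proof -
    have "card (\<Union>m\<in>{..?M}. ?E X m) \<le> (?M + 1) * (n ^ 3) ^ ?M" if X: "X \<in> ?Xs" for X
    proof -
      have "card (\<Union>m\<in>{..?M}. ?E X m) \<le> (\<Sum>m\<in>{..?M}. card (?E X m))" by (rule card_UN_le) simp
      also have "\<dots> \<le> (\<Sum>m\<in>{..?M}. (n ^ 3) ^ ?M)"
      proof (rule sum_mono)
        fix m assume "m \<in> {..?M}"
        then have "(n ^ 3) ^ m \<le> (n ^ 3) ^ ?M" using n0 by (intro power_increasing) auto
        then show "card (?E X m) \<le> (n ^ 3) ^ ?M" using E(2)[OF X, of m] by linarith
      qed
      finally show ?thesis by simp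
    qed
    then have "(\<Sum>X\<in>?Xs. card (\<Union>m\<in>{..?M}. ?E X m)) \<le> (\<Sum>X\<in>?Xs. (?M + 1) * (n ^ 3) ^ ?M)"
      by (rule sum_mono)
    moreover have "card ?F \<le> (\<Sum>X\<in>?Xs. card (\<Union>m\<in>{..?M}. ?E X m))" by (rule card_UN_le[OF fXs])
    moreover have "(\<Sum>X\<in>?Xs. (?M + 1) * (n ^ 3) ^ ?M) = card ?Xs * ((?M + 1) * (n ^ 3) ^ ?M)" by simp
    moreover have "\<dots> \<le> (card V + 1) ^ ?s * ((?M + 1) * (n ^ 3) ^ ?M)"
      by (rule mult_right_mono[OF card_subsets_le[OF finite_V]]) simp
    ultimately show ?thesis by linarith
  qed
  \<comment> \<open>With \<open>n = a^4\<close>, the assumption \<open>K^2 \<le> n\<close> gives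
    \<open>i \<le> 2 * a^3\<close>, while \<open>ln n \<le> 4 * a\<close>; so
    \<open>i * ln n\<close> is \<open>O(n)\<close>.\<close>
  have cM: "real ((?M + 1) * (n ^ 3) ^ ?M) \<le> exp (240 * real n)"
  proof -
    obtain a where a: "a \<ge> 1" "a ^ 4 = real n" "ln (real n) \<le> 4 * a" using ln_le_fourth_root[OF n0] .
    have a42: "(a\<^sup>2)\<^sup>2 = real n" using a(2) power_mult[of a 2 2] by simp
    have "K \<le> a\<^sup>2"
    proof (rule power2_le_imp_le)
      show "K\<^sup>2 \<le> (a\<^sup>2)\<^sup>2" using n(2) a42 by linarith
    qed simp
    then have "K * a ^ 4 \<le> a\<^sup>2 * a ^ 4" by (rule mult_right_mono) (use a(1) in simp)
    then have "K * real n \<le> a\<^sup>2 * a ^ 4" unfolding a(2) .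
    also have "\<dots> = (a ^ 3)\<^sup>2" unfolding power_mult[symmetric] power_add[symmetric] by simp
    finally have "sqrt (K * real n) \<le> a ^ 3" using a(1) by (intro real_le_lsqrt) auto
    moreover have "sqrt (K * real n) \<ge> 0" using K by simp
    then have "real i \<le> sqrt (K * real n) + 1" unfolding i_def by linarith
    moreover have "1 \<le> a ^ 3" using a(1) by (rule one_le_power)
    ultimately have i_le: "real i \<le> 2 * a ^ 3" by linarith
    have a34: "a ^ 3 * a = real n" using a(2) power_Suc2[of a 3] by simp
    have "real ((?M + 1) * (n ^ 3) ^ ?M) = (1 + real ?M) * real n ^ (3 * ?M)"
      by (simp only: of_nat_mult of_nat_add of_nat_power of_nat_1 power_mult add.commute)
    also have "\<dots> \<le> exp (real ?M) * exp (real (3 * ?M) * ln (real n))"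
    proof (rule mult_mono)
      have "real n ^ (3 * ?M) = exp (ln (real n)) ^ (3 * ?M)" using n0 by simp
      also have "\<dots> = exp (real (3 * ?M) * ln (real n))" by (rule exp_of_nat_mult[symmetric])
      finally show "real n ^ (3 * ?M) \<le> exp (real (3 * ?M) * ln (real n))" by simp
    qed (auto intro: exp_ge_add_one_self)
    also have "\<dots> = exp (real ?M + real (3 * ?M) * ln (real n))" by (simp add: exp_add)
    also have "\<dots> \<le> exp (240 * real n)"
    proof -
      have "real i \<le> 2 * real n"
        using i_le a34 mult_left_mono[of 1 a "a ^ 3"] a(1) by auto
      moreover have "real i * ln (real n) \<le> (2 * a ^ 3) * (4 * a)"
        using i_le a n0 by (intro mult_mono) auto
      then have "real i * ln (real n) \<le> 8 * real n" using a34 by simp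
      ultimately have "real ?M + real (3 * ?M) * ln (real n) \<le> 240 * real n" by simp
      then show ?thesis by simp
    qed
    finally show ?thesis .
  qed
  \<comment> \<open>No extra vertices \<open>Y\<close> are named here, so \<open>weight_step\<close>
    is used with budget 0.\<close>
  have sub: "?G \<subseteq> {Z \<union> B |Z Y B. Z \<in> ?F \<and> Y \<subseteq> V \<and> card Y \<le> 0 \<and>
      real (card (rich i Z)) \<le> 176 * (K * real n) \<and> B \<subseteq> rich i Z - Z}"
  proof
    fix S assume "S \<in> ?G"
    then have S: "S \<subseteq> V" "card S = n" "real (card (cols S S)) \<le> K * real n" by auto
    obtain X Z m where *: "X \<subseteq> V" "real (card X) \<le> 1 + 14 * K + 16 * ln (real n)" "m \<le> ?M"
        "extends X m Z" "Z \<subseteq> S" "S - Z \<subseteq> rich i Z" "real (card (rich i Z)) \<le> 176 * (K * real n)"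
      using ex_rich_extension_bounds[OF S K n(1)] unfolding i_def by blast
    have "card X \<le> ?s" using *(2) by linarith
    moreover have "card Z \<le> n" using *(5) S card_mono[OF finite_subset[OF S(1) finite_V]] by blast
    ultimately have "Z \<in> ?F" using *(1,3,4) by blast
    moreover have "S = Z \<union> (S - Z)" using *(5) by auto
    moreover have "S - Z \<subseteq> rich i Z - Z" using *(6) by auto
    ultimately show "S \<in> {Z \<union> B |Z Y B. Z \<in> ?F \<and> Y \<subseteq> V \<and> card Y \<le> 0 \<and>
      real (card (rich i Z)) \<le> 176 * (K * real n) \<and> B \<subseteq> rich i Z - Z}"
      using *(7) card.empty by blast
  qed
  have G: "finite ?G \<and> weight x ?G \<le> ?N ^ 0 * exp (x * (176 * (K * real n))) * weight x ?F"
  proof (rule weight_step[where base = "\<lambda>Z Y. Z" and cand = "\<lambda>Z Y. rich i Z",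
        OF finite_V fF less_imp_le[OF x(1)] x(2) _ sub])
    fix Z Y assume "Z \<in> ?F"
    then show "finite Z \<and> finite (rich i Z) \<and> Z \<subseteq> Z"
      using finite_subset[OF F_sub finite_V] finite_rich by blast
  qed (use K in simp)
  have W: "weight x ?F \<le> ?N ^ ?s * exp (240 * real n)"
  proof -
    have "weight x ?F \<le> (\<Sum>Z\<in>?F. 1)"
      unfolding weight_def by (rule sum_mono) (use x in \<open>simp add: power_le_one\<close>)
    also have "\<dots> = real (card ?F)" by simp
    also have "\<dots> \<le> real ((card V + 1) ^ ?s * ((?M + 1) * (n ^ 3) ^ ?M))" using cF by (rule of_nat_mono)
    also have "\<dots> = ?N ^ ?s * real ((?M + 1) * (n ^ 3) ^ ?M)" by (simp only: of_nat_mult of_nat_power)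
    also have "\<dots> \<le> ?N ^ ?s * exp (240 * real n)" using cM by (intro mult_left_mono) auto
    finally show ?thesis .
  qed
  have "real (card ?G) = (1 / x) ^ n * weight x ?G" by (rule card_eq_weight) (use G x in auto)
  also have "\<dots> = (2 * K) ^ n * weight x ?G" unfolding x_def by simp
  also have "\<dots> \<le> (2 * K) ^ n * (exp (x * (176 * (K * real n))) * weight x ?F)"
    using G K by (intro mult_left_mono) auto
  also have "\<dots> \<le> (2 * K) ^ n * (exp (x * (176 * (K * real n))) * (?N ^ ?s * exp (240 * real n)))"
    using W K by (intro mult_left_mono) auto
  also have "x * (176 * (K * real n)) = 88 * real n" unfolding x_def using K by simp
  also have "(2 * K) ^ n * (exp (88 * real n) * (?N ^ ?s * exp (240 * real n)))
      = (2 * K) ^ n * exp (88 * real n + 240 * real n) * ?N ^ ?s"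
    by (simp only: exp_add mult_ac)
  also have "\<dots> \<le> (2 * K) ^ n * exp (330 * real n) * ?N ^ ?s"
    using K by (intro mult_right_mono mult_left_mono) auto
  finally show ?thesis .
qed

end

section \<open>Edge-colorings and the final bound\<close>

lemma proper_edge_coloring_locale:
  assumes "proper_edge_coloring N c"
  shows "proper_coloring {..<N} (\<lambda>u v. c {u, v})"
proof
  fix v u w assume *: "v \<in> {..<N}" "u \<in> {..<N}" "w \<in> {..<N}" "u \<noteq> v" "w \<noteq> v" "c {v, u} = c {v, w}"
  let ?E = "{e \<in> color_class N c (c {v, u}). v \<in> e}"
  have "card ?E \<le> 1"
    using assms *(1) unfolding proper_edge_coloring_def is_matching_def edge_degree_def by auto
  moreover have "{v, u} \<in> ?E" "{v, w} \<in> ?E"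
    using * unfolding color_class_def nsets_def by auto
  moreover have "finite ?E"
    unfolding color_class_def by (simp add: finite_imp_finite_nsets)
  ultimately have "{v, u} = {v, w}" by (metis One_nat_def card_le_Suc0_iff_eq)
  then show "u = w" by (auto simp: doubleton_eq_iff)
qed (auto simp: insert_commute)

lemma colors_inside_eq_cols:
  assumes "proper_coloring V (\<lambda>u v. c {u, v})"
  shows "colors_inside c S = proper_coloring.cols (\<lambda>u v. c {u, v}) S S"
  unfolding proper_coloring.cols_def[OF assms] colors_inside_def nsets_def
  by (auto simp: card_2_iff image_iff)

lemma power_le_powr:
  assumes "1 \<le> (a::real)" "real e \<le> b"
  shows "a ^ e \<le> a powr b"
  using assms powr_mono[of "real e" b a] by (simp add: powr_realpow)

text \<open>The condition relating \<open>n\<close> and \<open>K\<close> excludes singletons with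
  small \<open>K\<close>: a single vertex spans no colour, so all \<open>N\<close> singletons are
  counted, whereas the bound tends to 0 with \<open>K\<close>. In the remaining cases,
  \<open>n \<le> 8 * K\<close> is trivial, and otherwise the comparison of \<open>K^2\<close> with
  \<open>n\<close> selects the counting lemma.\<close>

theorem theorem1p4:
  "\<exists>C::real. \<forall>(N::nat) (c :: nat set \<Rightarrow> nat) (n::nat) (K::real).
     proper_edge_coloring N c \<longrightarrow> n \<ge> 1 \<longrightarrow> K > 0 \<longrightarrow> (n \<ge> 2 \<or> K \<ge> 1 / 2) \<longrightarrow>
     real (card {S \<in> nsets {..<N} n. real (card (colors_inside c S)) \<le> K * real n})
       \<le> real N powr (C * (K + ln (real n))) * (C * K) ^ n"
proof -
  \<comment> \<open>The first summand covers the exponents of \<open>N\<close>, the second turns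
    \<open>(2 * K) ^ n * exp (330 * n)\<close> into a power of \<open>C * K\<close>.\<close>
  define C :: real where "C = 20000 + 2 * exp 330"
  have C: "C \<ge> 20000" "C \<ge> 2 * exp 330" unfolding C_def by auto
  have "real (card {S \<in> nsets {..<N} n. real (card (colors_inside c S)) \<le> K * real n})
       \<le> real N powr (C * (K + ln (real n))) * (C * K) ^ n"
    if c: "proper_edge_coloring N c" and n: "n \<ge> 1" and K: "K > 0" and nK: "n \<ge> 2 \<or> K \<ge> 1 / 2"
    for N n :: nat and c K
  proof -
    let ?A = "{S \<in> nsets {..<N} n. real (card (colors_inside c S)) \<le> K * real n}"
    let ?R = "real N powr (C * (K + ln (real n))) * (C * K) ^ n"
    interpret proper_coloring "{..<N}" "\<lambda>u v. c {u, v}" using c by (rule proper_edge_coloring_locale)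
    have A_eq: "?A = {S. S \<subseteq> {..<N} \<and> card S = n \<and> real (card (cols S S)) \<le> K * real n}"
      unfolding nsets_def using colors_inside_eq_cols[OF proper_coloring_axioms] finite_subset[of _ "{..<N}"]
      by auto
    have ln0: "ln (real n) \<ge> 0" using n by simp
    have exp_le: "E \<le> C * (K + ln (real n))" if "E \<le> 20000 * (K + ln (real n))" for E
      using that mult_right_mono[OF C(1), of "K + ln (real n)"] K ln0 by linarith
    have base_le: "(2 * K) ^ n * exp (b * real n) \<le> (C * K) ^ n" if "b \<le> 330" for b
    proof -
      have "(2 * K) ^ n * exp (b * real n) = (2 * exp b * K) ^ n"
        by (simp add: power_mult_distrib exp_of_nat2_mult)
      also have "\<dots> \<le> (C * K) ^ n"
      proof (intro power_mono mult_right_mono)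
        have "exp b \<le> exp 330" using that by simp
        then show "2 * exp b \<le> C" using C(2) by linarith
      qed (use K in auto)
      finally show ?thesis .
    qed
    have R0: "0 \<le> ?R" using K C(1) by simp
    show ?thesis
    proof (cases "?A = {}")
      case True then show ?thesis using R0 by (simp only: card.empty of_nat_0)
    next
      case False
      then obtain S where S: "S \<subseteq> {..<N}" "card S = n" "real (card (cols S S)) \<le> K * real n"
        unfolding A_eq by auto
      have fS: "finite S" using S(1) finite_subset by blast
      have nN: "n \<le> N" using card_mono[OF _ S(1)] S(2) by simp
      \<comment> \<open>For \<open>n \<ge> 2\<close>, the edges of \<open>S\<close> at one vertex
        already have \<open>n - 1 \<ge> n/2\<close> colours.\<close>
      have K2: "K \<ge> 1/2"
      proof (cases "n \<ge> 2")
        case True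
        obtain v where v: "v \<in> S" using S(2) n by fastforce
        have "n - 1 = card ((\<lambda>u. c {v, u}) ` (S - {v}))"
          using inj_on_star[of v "S - {v}"] v S fS by (subst card_image) auto
        also have "\<dots> \<le> card (cols S S)"
          using v by (intro card_mono finite_cols fS) (auto intro: colsI)
        finally have "real n - 1 \<le> K * real n" using S(3) by linarith
        moreover have "real n / 2 \<le> real n - 1" using True by simp
        ultimately have "1/2 * real n \<le> K * real n" by linarith
        then show ?thesis using n by (simp only: mult_le_cancel_right)
      qed (use nK in auto)
      show ?thesis
      proof (cases "8 * K < real n")
        case False
        have "card ?A \<le> card (nsets {..<N} n)"
          by (intro card_mono finite_imp_finite_nsets) auto
        also have "\<dots> \<le> N ^ n" using nN by (simp add: card_nsets binomial_le_pow)
        finally have "real (card ?A) \<le> real (N ^ n)" by (rule of_nat_mono)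
        also have "\<dots> = real N ^ n" by (rule of_nat_power)
        also have "\<dots> \<le> real N powr (C * (K + ln (real n)))"
        proof (intro power_le_powr exp_le)
          show "1 \<le> real N" using nN n by simp
          have "real n \<le> 8 * K" using False by simp
          also have "\<dots> \<le> 20000 * (K + ln (real n))" using K ln0 by (simp add: distrib_left)
          finally show "real n \<le> 20000 * (K + ln (real n))" .
        qed
        also have "\<dots> \<le> ?R"
        proof -
          have "1 \<le> C * K" using C(1) K2 mult_mono[of 2 C "1/2" K] by simp
          then have "1 \<le> (C * K) ^ n" by (rule one_le_power)
          then show ?thesis by (simp add: mult_le_cancel_left1)
        qed
        finally show ?thesis .
      next
        case True
        have N2: "N \<ge> 2" using True K2 nN by linarith
        have N1: "real N \<ge> 1" using N2 by simp
        \<comment> \<open>The counting lemmas yield powers of \<open>N + 1\<close>, and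
          \<open>N + 1 \<le> N^2\<close> for \<open>N \<ge> 2\<close>.\<close>
        have succ: "real (card {..<N} + 1) ^ e \<le> real N ^ (2 * e)" for e
        proof -
          have "real N + 1 \<le> 2 * real N" using N1 by simp
          also have "\<dots> \<le> real N * real N" using N2 by (intro mult_right_mono) auto
          finally have "(real N + 1) ^ e \<le> (real N ^ 2) ^ e" by (intro power_mono) (auto simp: power2_eq_square)
          then show ?thesis by (simp add: power_mult add.commute)
        qed
        show ?thesis
        proof (cases "K\<^sup>2 \<le> real n")
          case small: True
          let ?s = "nat \<lfloor>1 + 14 * K + 16 * ln (real n)\<rfloor>"
          have "real ?s \<le> 1 + 14 * K + 16 * ln (real n)" using K ln0 by linarith
          then have "real (2 * ?s) \<le> 20000 * (K + ln (real n))"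
            using K2 ln0 unfolding of_nat_mult of_nat_numeral distrib_left by linarith
          then have p: "real N ^ (2 * ?s) \<le> real N powr (C * (K + ln (real n)))"
            by (intro power_le_powr exp_le N1)
          have "real (card ?A) \<le> (2 * K) ^ n * exp (330 * real n) * real (card {..<N} + 1) ^ ?s"
            unfolding A_eq by (rule count_small_K[OF K2 True small])
          also have "\<dots> \<le> (C * K) ^ n * real N powr (C * (K + ln (real n)))"
            using base_le[of 330] order_trans[OF succ p] K C(1) by (intro mult_mono) auto
          finally show ?thesis by (simp add: mult.commute)
        next
          case False
          let ?s = "nat \<lceil>5020 * K\<rceil>" and ?t = "nat \<lceil>5530 * K\<rceil>"
          have "real ?s \<le> 5020 * K + 1" "real ?t \<le> 5530 * K + 1" using K by linarith+
          then have "real (2 * ?s + ?t) \<le> 20000 * (K + ln (real n))"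
            using K2 ln0 unfolding of_nat_add of_nat_mult of_nat_numeral distrib_left by linarith
          then have p: "real N ^ (2 * ?s + ?t) \<le> real N powr (C * (K + ln (real n)))"
            by (intro power_le_powr exp_le N1)
          have "real (card ?A) \<le> (2 * K) ^ n * exp (260 * real n) * real (card {..<N} + 1) ^ ?s * 2 ^ ?t"
            unfolding A_eq by (rule count_large_K[OF K2 True]) (use False in simp)
          also have "\<dots> = ((2 * K) ^ n * exp (260 * real n)) * (real (card {..<N} + 1) ^ ?s * 2 ^ ?t)"
            by (simp only: mult.assoc)
          also have "\<dots> \<le> (C * K) ^ n * (real N ^ (2 * ?s) * real N ^ ?t)"
            using base_le[of 260] succ[of ?s] N2 K C(1) by (intro mult_mono power_mono) auto
          also have "\<dots> \<le> (C * K) ^ n * real N powr (C * (K + ln (real n)))"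
            using p K C(1) by (intro mult_left_mono) (auto simp: power_add)
          finally show ?thesis by (simp add: mult.commute)
        qed
      qed
    qed
  qed
  then show ?thesis by blast
qed

end
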